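(* Let $(X,\|\cdot\|_X)$ and $(W,\|\cdot\|_W)$ be Banach spaces such that $X\hookrightarrow W$ continuously. Let $J\in C^1(X,\mathbb{R})$ be an even functional such that $J(0)=0$ and the weak Cerami--Palais--Smale condition $(wCPS)$ holds in $\mathbb{R}_+=(0,+\infty)$, i.e. $J$ satisfies $(wCPS)_\beta$ at each level $\beta\in\mathbb{R}_+$. Moreover, assume that $\varrho>0$ exists so that three closed subsets $V_\varrho$, $Z_\varrho$ and $\mathcal{M}_\varrho$ of $X$ and a constant $R_\varrho>0$ exist which satisfy the following conditions: (i) $V_\varrho$ and $Z_\varrho$ are subspaces of $X$ such that $V_\varrho+Z_\varrho=X$ and $\operatorname{codim}Z_\varrho<\dim V_\varrho<+\infty$; (ii) $\mathcal{M}_\varrho=\partial\mathcal{N}$, where $\mathcal{N}\subset X$ is a neighborhood of the origin which is symmetric and bounded with respect to $\|\cdot\|_W$; (iii) if $u\in\mathcal{M}_\varrho\cap Z_\varrho$, then $J(u)\ge\varrho$; (iv) if $u\in V_\varrho$ and $\|u\|_X\ge R_\varrho$, then $J(u)\le0$. Then, if we put $$\beta_\varrho=\inf_{\gamma\in\Gamma_\varrho}\ \sup_{u\in V_\varrho}J(\gamma(u)),$$ with $$\Gamma_\varrho=\{\gamma:X\to X:\ \gamma\text{ odd homeomorphism},\ \gamma(u)=u\text{ if }u\in V_\varrho\text{ with }\|u\|_X\ge R_\varrho\},$$ the functional $J$ possesses at least a pair of symmetric critical points in $X$ with corresponding critical level $\beta_\varrho$ which belongs to $[\varrho,\varrho_1]$,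 where $\varrho_1\ge\sup_{u\in V_\varrho}J(u)>\varrho$.
   Context: $X\hookrightarrow W$ continuously means $X\subset W$ and there is $\sigma_0>0$ with $\|u\|_W\le\sigma_0\|u\|_X$ for all $u\in X$. The functional $J$ is defined on a set $\mathcal{D}\subset W$ with $X\subset\mathcal{D}$, and is $C^1$ on $X$ equipped with $\|\cdot\|_X$. Unless another norm is named, topological notions in $X$ (closed, neighborhood, boundary $\partial$, homeomorphism) refer to $\|\cdot\|_X$; symmetric means symmetric with respect to the origin; $X'$ is the dual of $X$, with norm $\|\cdot\|_{X'}$. A critical point of $J$ in $X$ is a $u\in X$ with $dJ(u)=0$, and its critical level is $J(u)$. For $\beta\in\mathbb{R}$, a $(CPS)_\beta$-sequence is a sequence $(u_n)_n\subset X$ with $J(u_n)\to\beta$ and $\|dJ(u_n)\|_{X'}(1+\|u_n\|_X)\to0$ as $n\to+\infty$. $J$ satisfies the weak Cerami--Palais--Smale condition at level $\beta$, $(wCPS)_\beta$, if for every $(CPS)_\beta$-sequence $(u_n)_n$ a point $u\in X$ exists such that $\|u_n-u\|_W\to0$ (up to subsequences), and $J(u)=\beta$, $dJ(u)=0$.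
   Formalization: The strict inequality sup J > ϱ over V is replaced by sup J ≥ ϱ: it fails for X=W=V=Z=ℝ, J(u)=2u²−u⁴, N=[−1,1], ϱ=1, R=2, where sup J = 1 = ϱ; the level is shown to lie in [ϱ,ϱ₁] for every ϱ₁ ≥ sup J. *)

theory Defs
  imports "HOL-Analysis.Analysis" "HOL-Library.Extended_Nat"
begin

text \<open>
  The spaces \<open>X\<close> and \<open>W\<close> are Banach space types, and the continuous inclusion of \<open>X\<close> in \<open>W\<close>
  is an injective bounded linear map \<open>\<iota>\<close>, so that the \<open>W\<close>-norm of \<open>u\<close> is \<open>norm (\<iota> u)\<close>.
  Only the values of \<open>J\<close> on \<open>X\<close> occur. The derivative \<open>dJ\<close> takes values in the dual space
  \<open>'x \<Rightarrow>\<^sub>L real\<close>, whose norm is the operator norm.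
\<close>

definition CPS_seq ::
  "('x::banach \<Rightarrow> real) \<Rightarrow> ('x \<Rightarrow> 'x \<Rightarrow>\<^sub>L real) \<Rightarrow> real \<Rightarrow> (nat \<Rightarrow> 'x) \<Rightarrow> bool" where
  "CPS_seq J dJ \<beta> u \<longleftrightarrow>
     (\<lambda>n. J (u n)) \<longlonglongrightarrow> \<beta> \<and> (\<lambda>n. norm (dJ (u n)) * (1 + norm (u n))) \<longlonglongrightarrow> 0"

definition wCPS ::
  "('x::banach \<Rightarrow> 'w::banach) \<Rightarrow> ('x \<Rightarrow> real) \<Rightarrow> ('x \<Rightarrow> 'x \<Rightarrow>\<^sub>L real) \<Rightarrow> real \<Rightarrow> bool" where
  "wCPS \<iota> J dJ \<beta> \<longleftrightarrow>
     (\<forall>u. CPS_seq J dJ \<beta> u \<longrightarrow>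
        (\<exists>r x. strict_mono r \<and> (\<lambda>n. norm (\<iota> (u (r n)) - \<iota> x)) \<longlonglongrightarrow> 0 \<and> J x = \<beta> \<and> dJ x = 0))"

text \<open>
  The codimension of \<open>Z\<close> is the dimension of the quotient space by \<open>Z\<close>. The vectors of that space are
  the cosets of \<open>Z\<close>, and a linear combination of cosets is the coset of the same linear
  combination of representatives; in particular the zero vector is \<open>coset Z 0\<close>. A basis of the
  quotient is given by a set \<open>B\<close> of representatives, one for each of its elements.
\<close>

definition coset :: "'x::real_vector set \<Rightarrow> 'x \<Rightarrow> 'x set" where
  "coset Z x = (\<lambda>z. x + z) ` Z"

definition quotient_basis :: "'x::real_vector set \<Rightarrow> 'x set \<Rightarrow> bool" where
  "quotient_basis Z B \<longleftrightarrow>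
     (\<forall>T c. finite T \<and> T \<subseteq> B \<and> coset Z (\<Sum>b\<in>T. c b *\<^sub>R b) = coset Z 0 \<longrightarrow> (\<forall>b\<in>T. c b = 0)) \<and>
     (\<forall>x. \<exists>T c. finite T \<and> T \<subseteq> B \<and> coset Z x = coset Z (\<Sum>b\<in>T. c b *\<^sub>R b))"

definition codim :: "'x::real_vector set \<Rightarrow> enat" where
  "codim Z =
     (if \<exists>B. finite B \<and> quotient_basis Z B
      then enat (card (SOME B. finite B \<and> quotient_basis Z B)) else \<infinity>)"

lemma coset_eq_iff:
  assumes "subspace Z"
  shows "coset Z x = coset Z y \<longleftrightarrow> x - y \<in> Z"
proof
  assume "coset Z x = coset Z y"
  moreover have "x \<in> coset Z x"
    unfolding coset_def using subspace_0[OF assms] by force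
  ultimately show "x - y \<in> Z" unfolding coset_def by auto
next
  assume d: "x - y \<in> Z"
  have sub: "coset Z a \<subseteq> coset Z b" if "a - b \<in> Z" for a b
  proof
    fix w assume "w \<in> coset Z a"
    then obtain z where "z \<in> Z" "w = a + z" unfolding coset_def by auto
    then have "w = b + ((a - b) + z)" "(a - b) + z \<in> Z"
      using that subspace_add[OF assms] by auto
    then show "w \<in> coset Z b" unfolding coset_def by blast
  qed
  have "y - x \<in> Z" using subspace_neg[OF assms d] by simp
  then show "coset Z x = coset Z y" using sub d by blast
qed

lemma quotient_basis_card_le:
  assumes Z: "subspace Z" and A: "finite A" "quotient_basis Z A"
    and B: "finite B" "quotient_basis Z B"
  shows "card A \<le> card B"
proof -
  have spanB: "\<exists>y \<in> span B. x - y \<in> Z" for x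
  proof -
    from B(2) have "\<exists>T c. finite T \<and> T \<subseteq> B \<and> coset Z x = coset Z (\<Sum>b\<in>T. c b *\<^sub>R b)"
      unfolding quotient_basis_def by (elim conjE allE)
    then obtain T c where T: "T \<subseteq> B" "coset Z x = coset Z (\<Sum>b\<in>T. c b *\<^sub>R b)"
      by (elim exE conjE)
    have "(\<Sum>b\<in>T. c b *\<^sub>R b) \<in> span B"
      by (rule span_sum, rule span_scale, rule span_base, rule subsetD[OF T(1)])
    moreover have "x - (\<Sum>b\<in>T. c b *\<^sub>R b) \<in> Z"
      using T(2) by (simp only: coset_eq_iff[OF Z])
    ultimately show ?thesis by (rule bexI[rotated])
  qed
  then obtain f where f: "\<And>x. f x \<in> span B" "\<And>x. x - f x \<in> Z" by metis
  have lin0: "\<forall>a\<in>A. c a = 0" if s: "(\<Sum>a\<in>A. c a *\<^sub>R f a) = 0" for c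
  proof -
    have "(\<Sum>a\<in>A. c a *\<^sub>R a) = (\<Sum>a\<in>A. c a *\<^sub>R (a - f a))"
      using s by (simp add: scaleR_diff_right sum_subtractf)
    also have "\<dots> \<in> Z"
      by (intro subspace_sum[OF Z] subspace_scale[OF Z] f)
    finally have "coset Z (\<Sum>a\<in>A. c a *\<^sub>R a) = coset Z 0"
      by (simp only: coset_eq_iff[OF Z] diff_zero)
    with A(1) show ?thesis
      using conjunct1[OF A(2)[unfolded quotient_basis_def], rule_format, of A c] by simp
  qed
  have inj: "inj_on f A"
  proof (rule inj_onI, rule ccontr)
    fix x y assume xy: "x \<in> A" "y \<in> A" "f x = f y" "x \<noteq> y"
    let ?c = "\<lambda>a. if a = x then 1 else if a = y then - 1 else (0::real)"
    have "(\<Sum>a\<in>A. ?c a *\<^sub>R f a) = (\<Sum>a\<in>{x,y}. ?c a *\<^sub>R f a)"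
      using xy A by (intro sum.mono_neutral_right) auto
    also have "\<dots> = 0" using xy by simp
    finally have "(\<Sum>a\<in>A. ?c a *\<^sub>R f a) = 0" .
    from bspec[OF lin0[OF this] xy(1)] show False by simp
  qed
  have "u v = 0" if u: "(\<Sum>v\<in>f ` A. u v *\<^sub>R v) = 0" "v \<in> f ` A" for u v
  proof -
    have "(\<Sum>a\<in>A. u (f a) *\<^sub>R f a) = 0" using u(1) by (simp add: sum.reindex[OF inj])
    then show ?thesis using lin0[of "\<lambda>a. u (f a)"] u(2) by auto
  qed
  then have "independent (f ` A)"
    unfolding dependent_finite[OF finite_imageI[OF A(1)]] by metis
  then have "card (f ` A) \<le> card B"
    using independent_span_bound[OF B(1)] f by blast
  then show ?thesis using card_image[OF inj] by simp
qed

lemma codim_eq_card: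
  assumes "subspace Z" "finite B" "quotient_basis Z B"
  shows "codim Z = enat (card B)"
proof -
  let ?S = "SOME B. finite B \<and> quotient_basis Z B"
  have "finite ?S \<and> quotient_basis Z ?S" using assms by (intro someI) blast
  then have "card ?S = card B"
    using quotient_basis_card_le assms by (metis antisym)
  then show ?thesis unfolding codim_def using assms by auto
qed

definition \<Gamma> :: "'x::banach set \<Rightarrow> real \<Rightarrow> ('x \<Rightarrow> 'x) set" where
  "\<Gamma> V R = {\<gamma>. (\<exists>\<gamma>'. homeomorphism UNIV UNIV \<gamma> \<gamma>') \<and> (\<forall>u. \<gamma> (- u) = - \<gamma> u) \<and>
              (\<forall>u\<in>V. norm u \<ge> R \<longrightarrow> \<gamma> u = u)}"

text \<open>
  Under the hypotheses of the theorem the real-valued supremum and infimum here are genuine: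
  \<open>J \<circ> \<gamma>\<close> is bounded above on the finite-dimensional space \<open>V\<close>, because it is continuous and
  nonpositive outside a ball of \<open>V\<close>, the suprema are at least \<open>J (\<gamma> 0) = J 0 = 0\<close>,
  and \<open>\<Gamma> V R\<close> contains the identity.
\<close>

definition minimax_level :: "('x::banach \<Rightarrow> real) \<Rightarrow> 'x set \<Rightarrow> real \<Rightarrow> real" where
  "minimax_level J V R = (INF \<gamma>\<in>\<Gamma> V R. SUP u\<in>V. J (\<gamma> u))"

end

theory Submission
  imports Defs "HOL-Library.Z2" "HOL-Library.Multiset"
begin

text \<open>
  The number \<open>minimax_level J V R\<close> is at least \<open>\<rho>\<close> because every \<open>\<gamma> \<in> \<Gamma> V R\<close> maps
  some point of \<open>V\<close> into \<open>M \<inter> Z\<close>, and it is at most \<open>sup J\<close> over \<open>V\<close> because the identity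
  belongs to \<open>\<Gamma> V R\<close>. It is a critical value because near it there are points at which
  \<open>norm (dJ u) * (1 + norm u)\<close> is as small as desired (\<open>minimax_level_almost_critical\<close>): these form
  a Cerami-Palais-Smale sequence, and the weak compactness condition turns it into a critical point at
  that level. Without such points, maps in \<open>\<Gamma> V R\<close> could be deformed inside \<open>\<Gamma> V R\<close> so as to lower their
  suprema further than the choice of these maps permits.

  \<^bold>\<open>Intersection.\<close> Let \<open>U\<close> be the preimage of the interior of \<open>N\<close> under \<open>\<gamma>\<close>. It is an open
  symmetric neighborhood of \<open>0\<close>, and \<open>U \<inter> V\<close> is bounded: outside the ball of radius \<open>R\<close> the map
  \<open>\<gamma>\<close> fixes \<open>V\<close>, the set \<open>N\<close> is bounded in the norm of \<open>W\<close>, and on the finite-dimensional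
  space \<open>V\<close> that norm dominates the norm of \<open>X\<close>. The coordinates of \<open>\<gamma>\<close> modulo \<open>Z\<close> are
  \<open>k = codim Z < dim V\<close> odd continuous functions. By the Borsuk-Ulam theorem for the boundary of a bounded
  symmetric neighborhood (\<open>borsuk_common_zero\<close>) they vanish together at some \<open>p \<in> V\<close> on the
  boundary of \<open>U\<close>, which means that \<open>\<gamma> p\<close> lies in \<open>frontier N \<inter> Z\<close>.

  The Borsuk-Ulam theorem is proved by counting modulo 2, in the manner of Tucker and Ky Fan. Take
  the cubical lattice of small mesh in \<open>V\<close>, pass to its barycentric subdivision, and label each
  vertex with the index of the largest of the \<open>k\<close> functions there, together with its sign. If the
  functions had no common zero near the boundary, then near the boundary antipodal vertices would
  carry opposite labels and no edge would join opposite labels. The parity of the number of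
  simplices with alternating labels can then be passed down through the coordinate
  subspaces to the single point \<open>0\<close>, where it is \<open>1\<close>; but with fewer than \<open>dim V\<close> label indices no
  alternating simplex of top dimension exists (\<open>lattice_borsuk\<close>).

  \<^bold>\<open>Deformation.\<close> Suppose that \<open>norm (dJ u) * (1 + norm u)\<close> is bounded below by \<open>\<alpha> > 0\<close> where \<open>J u\<close> is
  close to the minimax level \<open>\<beta>\<close>. Only the values of a map on the compact set \<open>Q = V \<inter> cball 0 R\<close> matter, so
  no flow on all of \<open>X\<close> is required. Ekeland's argument yields maps \<open>g m \<in> \<Gamma> V R\<close> that
  converge uniformly on \<open>Q\<close>, such that no map reached from \<open>g m\<close>
  by a displacement that costs less, at a fixed rate \<open>c\<close>, than it lowers the supremum of \<open>J\<close> has a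
  supremum noticeably below that of \<open>g (Suc m)\<close>. The limit is merely
  continuous, but its image \<open>K\<close> of \<open>Q\<close> is compact, so finitely many descent directions, glued by Lipschitz bump
  functions, give an odd homeomorphism \<open>\<eta>\<close> of \<open>X\<close> close to the identity that lowers \<open>J\<close> on \<open>K\<close>
  at twice the rate \<open>c\<close> (\<open>odd_descent_homeomorphism\<close>). Then \<open>\<eta> \<circ> g m\<close> contradicts the choice of
  \<open>g m\<close> for large \<open>m\<close>. The Cerami weight \<open>1 + norm u\<close> is absorbed in \<open>c\<close>: if \<open>A\<close> bounds the norm of
  \<open>g 0\<close> on \<open>Q\<close>, then all the maps send \<open>Q\<close> into the ball of radius \<open>2 * A + 1\<close>, because the admissible total displacement also grows linearly in \<open>A\<close>.
\<close>

section \<open>Alternating labels modulo 2\<close>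

(* Elements of the two-element field are added as in a field, not bitwise. *)
declare add_bit_eq_xor [simp del] mult_bit_eq_and [simp del]

lemma bit_double [simp]: "a + a = (0 :: bit)"
  by (cases a) auto

text \<open>
  The involution pairs off the elements of \<open>S\<close>, and equal terms cancel modulo 2.
\<close>

lemma sum_involution_bit:
  fixes g :: "'a \<Rightarrow> bit"
  assumes "finite S" "\<And>x. x \<in> S \<Longrightarrow> h x \<in> S" "\<And>x. x \<in> S \<Longrightarrow> h (h x) = x"
    and "\<And>x. x \<in> S \<Longrightarrow> h x \<noteq> x" "\<And>x. x \<in> S \<Longrightarrow> g (h x) = g x"
  shows "sum g S = 0"
  using assms
proof (induction "card S" arbitrary: S rule: less_induct)
  case less
  show ?case
  proof (cases "S = {}")
    case False
    then obtain a where a: "a \<in> S" by blast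
    let ?T = "S - {a, h a}"
    have "sum g ?T = 0"
    proof (rule less.hyps)
      show "card ?T < card S" using a less.prems(1) by (intro psubset_card_mono) auto
    next
      fix x assume "x \<in> ?T"
      then show "h x \<in> ?T" using less.prems a by (metis DiffD1 DiffD2 DiffI insertE insertI1 insert_iff singletonD)
    qed (use less.prems in auto)
    moreover have "sum g S = sum g {a, h a} + sum g ?T"
      using a less.prems by (subst sum.subset_diff[of "{a, h a}"]) (auto simp: add.commute)
    moreover have "sum g {a, h a} = 0" using less.prems a by (simp add: eq_commute[of a])
    ultimately show ?thesis by simp
  qed simp
qed

fun alternates :: "bool \<Rightarrow> nat list \<Rightarrow> bool" where
  "alternates b [] \<longleftrightarrow> True"
| "alternates b (x # xs) \<longleftrightarrow> odd x = b \<and> alternates (\<not> b) xs"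

definition drop_nth :: "nat \<Rightarrow> 'a list \<Rightarrow> 'a list" where
  "drop_nth i xs = take i xs @ drop (Suc i) xs"

text \<open>
  Deleting the head of the list leaves the tail, which has to alternate on its own. Deleting a later entry
  leaves the head in place; if its parity is as prescribed, what remains is the same sum for
  the tail and the opposite starting parity.
\<close>

lemma sum_drop_nth_alternates:
  "(\<Sum>i<length xs. of_bool (alternates b (drop_nth i xs))) =
     (of_bool (alternates b xs) + of_bool (alternates (\<not> b) xs) :: bit)"
proof (induction xs arbitrary: b)
  case Nil
  show ?case by simp
next
  case (Cons x xs)
  have "(\<Sum>i<length (x # xs). of_bool (alternates b (drop_nth i (x # xs)))) =
      of_bool (alternates b xs) +
      (\<Sum>i<length xs. of_bool (odd x = b \<and> alternates (\<not> b) (drop_nth i xs)) :: bit)"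
    by (simp add: sum.lessThan_Suc_shift drop_nth_def del: sum.lessThan_Suc)
  also have "\<dots> = of_bool (alternates b (x # xs)) + of_bool (alternates (\<not> b) (x # xs))"
  proof (cases "odd x = b")
    case True
    have "(\<Sum>i<length xs. of_bool (odd x = b \<and> alternates (\<not> b) (drop_nth i xs)) :: bit)
        = of_bool (alternates (\<not> b) xs) + of_bool (alternates b xs)"
      using Cons.IH[of "\<not> b"] True by simp
    then show ?thesis using True by (simp add: add.commute add.left_commute)
  next
    case False
    then show ?thesis by simp
  qed
  finally show ?case .
qed

text \<open>
  A label \<open>c\<close> stands for a signed index: the index is \<open>c div 2\<close>, the sign is the parity, and \<open>flip\<close>
  reverses the sign. With this encoding the usual order of natural numbers sorts labels by their
  index.
\<close>

definition flip :: "nat \<Rightarrow> nat" where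
  "flip c = (if even c then Suc c else c - 1)"

lemma odd_flip [simp]: "odd (flip c) \<longleftrightarrow> even c"
  by (auto simp: flip_def)

lemma flip_flip [simp]: "flip (flip c) = c"
  by (auto simp: flip_def elim: oddE)

lemma flip_div_2: "flip c div 2 = c div 2"
  by (auto simp: flip_def elim!: evenE oddE)

lemma eq_or_flip: "c div 2 = d div 2 \<Longrightarrow> c = d \<or> c = flip d"
  by (auto simp: flip_def elim!: evenE oddE)

text \<open>
  This is Ky Fan's cochain modulo 2: its value on a simplex with the labels \<open>L\<close> is \<open>1\<close> if the signs alternate
  along the increasing indices and the first sign is positive.
\<close>

definition alternating :: "nat multiset \<Rightarrow> bit" where
  "alternating L = of_bool (alternates True (sorted_list_of_multiset L))"

lemma alternates_map_flip: "alternates b (map flip xs) \<longleftrightarrow> alternates (\<not> b) xs"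
  by (induction xs arbitrary: b) auto

text \<open>
  Fan's identity: modulo 2 the number of facets with alternating labels starting positively is \<open>1\<close> if the
  labels of the simplex alternate with either first sign, and \<open>0\<close> otherwise. After sorting it is the
  statement \<open>sum_drop_nth_alternates\<close> about parities; since no two labels are opposite, \<open>flip\<close> preserves
  the sorting.
\<close>

lemma sum_alternating_delete:
  assumes "\<And>c d. c \<in># L \<Longrightarrow> d \<in># L \<Longrightarrow> c \<noteq> flip d"
  shows "(\<Sum>c\<in>#L. alternating (L - {#c#})) = alternating L + alternating (image_mset flip L)"
proof -
  define xs where "xs = sorted_list_of_multiset L"
  have L: "L = mset xs" and s: "sorted xs" by (auto simp: xs_def)
  have del: "sorted_list_of_multiset (L - {#xs ! i#}) = drop_nth i xs" if "i < length xs" for i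
  proof -
    have "xs = take i xs @ xs ! i # drop (Suc i) xs" using that by (rule id_take_nth_drop)
    then have "mset xs = add_mset (xs ! i) (mset (drop_nth i xs))" 
      unfolding drop_nth_def by (metis mset_append mset.simps(2) union_mset_add_mset_right)
    then have "L - {#xs ! i#} = mset (drop_nth i xs)" by (simp add: L)
    moreover have "sorted (drop_nth i xs)"
      using s that unfolding drop_nth_def
      by (metis \<open>xs = take i xs @ xs ! i # drop (Suc i) xs\<close> sorted_append sorted_simps(2) list.set_intros(2))
    ultimately show ?thesis by (simp add: sorted_sort_id)
  qed
  have "(\<Sum>c\<in>#L. alternating (L - {#c#})) = (\<Sum>i<length xs. alternating (L - {#xs ! i#}))"
    unfolding L by (simp only: sum_mset_sum_list[symmetric] mset_map[symmetric] flip: sum_list_sum_nth)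
      (simp add: sum_mset_sum_list sum_list_sum_nth atLeast0LessThan flip: mset_map)
  also have "\<dots> = (\<Sum>i<length xs. of_bool (alternates True (drop_nth i xs)))"
    by (rule sum.cong) (auto simp: alternating_def del)
  also have "\<dots> = of_bool (alternates True xs) + of_bool (alternates False xs)"
    using sum_drop_nth_alternates[of True xs] by simp
  also have "of_bool (alternates False xs) = alternating (image_mset flip L)"
  proof -
    have "flip c \<le> flip d" if "c \<in># L" "d \<in># L" "c \<le> d" for c d
      using assms[OF that(1,2)] assms[OF that(2,1)] that(3)
      by (cases "c = d") (auto simp: flip_def split: if_splits)
    then have "sorted (map flip xs)" using s
      by (auto simp: L sorted_map intro: sorted_wrt_mono_rel[of xs "(\<le>)"])
    then have "sorted_list_of_multiset (image_mset flip L) = map flip xs"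
      by (simp add: L sorted_sort_id flip: mset_map)
    then show ?thesis by (simp add: alternating_def alternates_map_flip)
  qed
  finally show ?thesis by (simp add: alternating_def xs_def)
qed

text \<open>
  Neighbors in an alternating sorted list have different signs and are not opposite, so their
  indices differ. Hence there are as many indices as labels.
\<close>

lemma alternating_eq_0:
  assumes cf: "\<And>c d. c \<in># L \<Longrightarrow> d \<in># L \<Longrightarrow> c \<noteq> flip d"
    and bound: "\<And>c. c \<in># L \<Longrightarrow> c div 2 < k" and size: "k < size L"
  shows "alternating L = 0"
proof (rule ccontr)
  define xs where "xs = sorted_list_of_multiset L"
  have L: "L = mset xs" and s: "sorted xs" by (auto simp: xs_def)
  assume "alternating L \<noteq> 0"
  then have "alternates True xs" by (auto simp: alternating_def xs_def)
  have *: "sorted_wrt (<) (map (\<lambda>c. c div 2) xs)"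
    if "sorted xs" "alternates b xs" "\<forall>c\<in>set xs. \<forall>d\<in>set xs. c \<noteq> flip d" for b xs
    using that
  proof (induction xs arbitrary: b)
    case (Cons x xs)
    have IH: "sorted_wrt (<) (map (\<lambda>c. c div 2) xs)" by (rule Cons.IH[of "\<not> b"]) (use Cons.prems in auto)
    show ?case
    proof (cases xs)
      case Nil then show ?thesis by simp
    next
      case (Cons y ys)
      have "x \<le> y" "odd x \<noteq> odd y" "x \<noteq> flip y"
        using Cons Cons.prems by auto
      then have "x div 2 < y div 2" using eq_or_flip[of x y] by (metis div_le_mono le_neq_implies_less)
      then show ?thesis using IH Cons by auto
    qed
  qed simp
  have "distinct (map (\<lambda>c. c div 2) xs)"
    using *[OF s \<open>alternates True xs\<close>] cf by (auto simp: L strict_sorted_iff)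
  then have "length xs = card ((\<lambda>c. c div 2) ` set xs)"
    by (metis distinct_card length_map list.set_map)
  also have "\<dots> \<le> card {..<k}" using bound by (intro card_mono) (auto simp: L)
  finally show False using size by (simp add: L)
qed

section \<open>Flags of lattice cubes\<close>

text \<open>
  A point of the integer lattice is the center of a cube of the cubical complex with edge length 2:
  the cube is degenerate in the directions of even coordinates and has length 2 in those of
  odd coordinates. A step leads from a cube to a cube of the next dimension that has it as a facet.
\<close>

definition cell_step :: "(nat \<Rightarrow> int) \<Rightarrow> (nat \<Rightarrow> int) \<Rightarrow> bool" where
  "cell_step x y \<longleftrightarrow> (\<exists>l. even (x l) \<and> (\<exists>s\<in>{-1, 1}. y = x(l := x l + s)))"

text \<open>
  The centers of a complete flag of cubes in the first \<open>n\<close> coordinates, which is a simplex of full dimension \<open>n\<close> in the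
  barycentric subdivision. The entries beyond \<open>n\<close> are fixed to make the set of flags in a
  finite set of points finite.
\<close>

definition flag :: "nat \<Rightarrow> (nat \<Rightarrow> nat \<Rightarrow> int) \<Rightarrow> bool" where
  "flag n x \<longleftrightarrow> (\<forall>l. even (x 0 l)) \<and> (\<forall>i<n. cell_step (x i) (x (Suc i))) \<and>
     (\<forall>i\<le>n. \<forall>l\<ge>n. x i l = 0) \<and> (\<forall>i>n. x i = (\<lambda>_. 0))"

lemma flag_even_0: "flag n x \<Longrightarrow> even (x 0 l)"
  by (simp add: flag_def)

lemma flag_step: "flag n x \<Longrightarrow> i < n \<Longrightarrow> cell_step (x i) (x (Suc i))"
  by (simp add: flag_def)

lemma flag_stepE:
  assumes "flag n x" "i < n"
  obtains l s where "even (x i l)" "s \<in> {-1, 1}" "x (Suc i) = (x i)(l := x i l + s)"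
  using flag_step[OF assms] that unfolding cell_step_def by blast

lemma flag_step_predE:
  assumes "flag n x" "0 < i" "i \<le> n"
  obtains l s where "even (x (i - 1) l)" "s \<in> {-1, 1}" "x i = (x (i - 1))(l := x (i - 1) l + s)"
proof -
  have "i - 1 < n" "Suc (i - 1) = i" using assms by auto
  then show thesis using flag_stepE[OF assms(1), of "i - 1"] that by metis
qed

lemma flag_support: "flag n x \<Longrightarrow> i \<le> n \<Longrightarrow> l \<ge> n \<Longrightarrow> x i l = 0"
  by (simp add: flag_def)

lemma flag_beyond: "flag n x \<Longrightarrow> i > n \<Longrightarrow> x i = (\<lambda>_. 0)"
  by (simp add: flag_def)

text \<open>
  Along a flag each coordinate moves at most once, from an even number to a neighboring odd one.
\<close>

lemma flag_coordinate_cases: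
  assumes "flag n x" "i \<le> k" "k \<le> n"
  shows "x k l = x i l \<or> (even (x i l) \<and> odd (x k l) \<and> \<bar>x k l - x i l\<bar> = 1)"
  using assms(2,3)
proof (induction k rule: dec_induct)
  case (step k)
  obtain m s where m: "even (x k m)" "s \<in> {-1, 1}" "x (Suc k) = (x k)(m := x k m + s)"
    using flag_stepE[OF assms(1), of k] step.prems by auto
  show ?case
  proof (cases "l = m")
    case True
    then have "x k l = x i l" using m step by auto
    then show ?thesis using m True by auto
  next
    case False
    then show ?thesis using m step by auto
  qed
qed simp

lemma flag_dist:
  assumes "flag n x" "i \<le> n" "k \<le> n"
  shows "\<bar>x i l - x k l\<bar> \<le> 1"
  using flag_coordinate_cases[of n x i k l] flag_coordinate_cases[of n x k i l] assms
  by (cases "i \<le> k") auto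

lemma card_odd_flag:
  assumes "flag n x" "i \<le> n"
  shows "finite {l. odd (x i l)} \<and> card {l. odd (x i l)} = i"
  using assms(2)
proof (induction i)
  case 0
  then show ?case using flag_even_0[OF assms(1)] by simp
next
  case (Suc i)
  obtain m s where m: "even (x i m)" "s \<in> {-1, 1}" "x (Suc i) = (x i)(m := x i m + s)"
    using flag_stepE[OF assms(1), of i] Suc.prems by auto
  then have "{l. odd (x (Suc i) l)} = insert m {l. odd (x i l)}" by auto
  then show ?case using Suc m by auto
qed

lemma flag_top_odd:
  assumes "flag n x"
  shows "{l. odd (x n l)} = {..<n}"
proof (rule card_subset_eq)
  show "{l. odd (x n l)} \<subseteq> {..<n}"
    using flag_support[OF assms, of n] by (force simp: not_le)
  show "card {l. odd (x n l)} = card {..<n}" using card_odd_flag[OF assms, of n] by simp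
qed simp

lemma inj_on_flag:
  assumes "flag n x"
  shows "inj_on x {..n}"
  using card_odd_flag[OF assms] by (auto intro!: inj_onI) metis

lemma flag_updI:
  assumes "flag n x" "i \<le> n" "i = 0 \<Longrightarrow> \<forall>l. even (y l)"
    and "0 < i \<Longrightarrow> cell_step (x (i - 1)) y" "i < n \<Longrightarrow> cell_step y (x (Suc i))"
    and "\<And>l. l \<ge> n \<Longrightarrow> y l = 0"
  shows "flag n (x(i := y))"
  using assms unfolding flag_def by auto

text \<open>
  Every facet of a simplex of full dimension lies in exactly two such simplices. Here the second
  one is obtained by replacing the \<open>i\<close>-th vertex. An inner vertex is the corner of a
  parallelogram whose other corners are its predecessor, its successor and the new vertex; at
  either end of the flag, the old vertex is reflected in its only neighbor.
\<close>

definition exchange :: "nat \<Rightarrow> nat \<Rightarrow> (nat \<Rightarrow> nat \<Rightarrow> int) \<Rightarrow> nat \<Rightarrow> nat \<Rightarrow> int" where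
  "exchange n i x = x(i := \<lambda>l. x (if i = 0 then 1 else i - 1) l +
                           x (if i = n then n - 1 else Suc i) l - x i l)"

lemma exchange_same [simp]: "k \<noteq> i \<Longrightarrow> exchange n i x k = x k"
  by (simp add: exchange_def)

lemma exchange_exchange: "0 < n \<Longrightarrow> i \<le> n \<Longrightarrow> exchange n i (exchange n i x) = x"
  by (auto simp: exchange_def fun_eq_iff)

lemma flag_exchange_aux:
  assumes x: "flag n x" and "0 < n" "i \<le> n"
  shows "flag n (exchange n i x) \<and> exchange n i x i \<noteq> x i"
proof -
  define y where "y = exchange n i x i"
  have y: "y = (\<lambda>l. x (if i = 0 then 1 else i - 1) l + x (if i = n then n - 1 else Suc i) l - x i l)"
    by (simp add: y_def exchange_def)
  have exchange: "exchange n i x = x(i := y)" by (simp add: y exchange_def)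
  have supp: "y l = 0" if "l \<ge> n" for l
    unfolding y using flag_support[OF x _ that] assms by auto
  consider "i = 0" | "i = n" | "0 < i" "i < n" using assms by linarith
  then have "flag n (x(i := y)) \<and> y \<noteq> x i"
  proof cases
    case 1
    obtain l s where l: "even (x 0 l)" "s \<in> {-1, 1}" "x 1 = (x 0)(l := x 0 l + s)"
      using flag_stepE[OF x, of 0] assms by auto
    have y': "y = (x 0)(l := x 0 l + 2 * s)" using 1 l \<open>0 < n\<close> by (auto simp: y fun_eq_iff)
    have "cell_step y (x 1)" unfolding cell_step_def
      by (rule exI[of _ l]) (use l in \<open>auto simp: y'\<close>)
    moreover have "\<forall>l. even (y l)" using flag_even_0[OF x] by (simp add: y')
    moreover have "y \<noteq> x i" using l 1 by (auto simp: y' fun_eq_iff)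
    ultimately show ?thesis using 1 assms supp by (auto intro!: flag_updI)
  next
    case 2
    obtain l s where l: "even (x (n - 1) l)" "s \<in> {-1, 1}" "x n = (x (n - 1))(l := x (n - 1) l + s)"
      using flag_step_predE[OF x \<open>0 < n\<close> order_refl] by blast
    have y': "y = (x (n - 1))(l := x (n - 1) l - s)" using 2 l \<open>0 < n\<close> by (auto simp: y fun_eq_iff)
    have "cell_step (x (n - 1)) y" unfolding cell_step_def
      by (rule exI[of _ l]) (use l in \<open>auto simp: y'\<close>)
    moreover have "y \<noteq> x i" using l 2 by (auto simp: y' dest!: fun_cong[of _ _ l])
    ultimately show ?thesis using 2 assms supp by (auto intro!: flag_updI)
  next
    case 3
    obtain l s where l: "even (x (i - 1) l)" "s \<in> {-1, 1}" "x i = (x (i - 1))(l := x (i - 1) l + s)"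
      using flag_step_predE[OF x \<open>0 < i\<close> \<open>i \<le> n\<close>] by blast
    obtain m t where m: "even (x i m)" "t \<in> {-1, 1}" "x (Suc i) = (x i)(m := x i m + t)"
      using flag_stepE[OF x, of i] 3 by auto
    have "m \<noteq> l" using l m by auto
    have y': "y = (x (i - 1))(m := x (i - 1) m + t)"
      using 3 l m \<open>m \<noteq> l\<close> by (auto simp: y fun_eq_iff)
    have "cell_step (x (i - 1)) y" unfolding cell_step_def
      by (rule exI[of _ m]) (use l m \<open>m \<noteq> l\<close> in \<open>auto simp: y'\<close>)
    moreover have "cell_step y (x (Suc i))" unfolding cell_step_def
      by (rule exI[of _ l]) (use l m \<open>m \<noteq> l\<close> in \<open>auto simp: y' fun_eq_iff\<close>)
    moreover have "y \<noteq> x i" using l m \<open>m \<noteq> l\<close> by (auto simp: y' dest!: fun_cong[of _ _ l])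
    ultimately show ?thesis using 3 assms supp by (auto intro!: flag_updI)
  qed
  then show ?thesis by (simp add: exchange)
qed

lemmas flag_exchange = conjunct1[OF flag_exchange_aux] and exchange_neq = conjunct2[OF flag_exchange_aux]

lemma flag_uminus: "flag n x \<Longrightarrow> flag n (\<lambda>i l. - x i l)"
proof -
  assume x: "flag n x"
  have "cell_step (\<lambda>l. - x i l) (\<lambda>l. - x (Suc i) l)" if i: "i < n" for i
  proof -
    obtain m s where m: "even (x i m)" "s \<in> {-1, 1}" "x (Suc i) = (x i)(m := x i m + s)"
      using flag_stepE[OF x i] by auto
    show ?thesis unfolding cell_step_def
      by (rule exI[of _ m]) (use m in \<open>auto simp: fun_eq_iff\<close>)
  qed
  then show ?thesis using x by (simp add: flag_def)
qed

definition flags_in :: "nat \<Rightarrow> (nat \<Rightarrow> int) set \<Rightarrow> (nat \<Rightarrow> nat \<Rightarrow> int) set" where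
  "flags_in n D = {x. flag n x \<and> (\<forall>i\<le>n. x i \<in> D)}"

definition half_flags :: "nat \<Rightarrow> (nat \<Rightarrow> int) set \<Rightarrow> (nat \<Rightarrow> nat \<Rightarrow> int) set" where
  "half_flags n D = {x \<in> flags_in n D. 0 < x n (n - 1)}"

definition face :: "nat \<Rightarrow> nat \<Rightarrow> (nat \<Rightarrow> nat \<Rightarrow> int) \<Rightarrow> (nat \<Rightarrow> int) set" where
  "face n i x = x ` ({..n} - {i})"

definition adjacent :: "(nat \<Rightarrow> int) set \<Rightarrow> bool" where
  "adjacent T \<longleftrightarrow> (\<forall>u\<in>T. \<forall>v\<in>T. \<forall>l. \<bar>u l - v l\<bar> \<le> 1)"

text \<open>
  The faces contained in \<open>D\<close> that form a simplex together with some lattice point outside \<open>D\<close>. The parameter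
  \<open>N\<close> is the dimension of the ambient lattice, in which that point is sought.
\<close>

definition near_boundary :: "nat \<Rightarrow> (nat \<Rightarrow> int) set \<Rightarrow> (nat \<Rightarrow> int) set \<Rightarrow> bool" where
  "near_boundary N D T \<longleftrightarrow> finite T \<and> T \<subseteq> D \<and>
     (\<exists>w. w \<notin> D \<and> (\<forall>l\<ge>N. w l = 0) \<and> adjacent (insert w T))"

lemma finite_flags_in: "finite D \<Longrightarrow> finite (flags_in n D)"
  by (rule finite_subset[OF _ finite_set_of_finite_funs[of "{..n}" D "\<lambda>_. 0"]])
    (auto simp: flags_in_def flag_beyond)

lemma adjacent_flag: "flag n x \<Longrightarrow> adjacent (x ` {..n})"
  using flag_dist by (auto simp: adjacent_def)

lemma near_boundary_face:
  assumes "flag n z" "i \<le> n" "n \<le> N" "z i \<notin> D" "\<And>k. k \<le> n \<Longrightarrow> k \<noteq> i \<Longrightarrow> z k \<in> D"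
  shows "near_boundary N D (z ` ({..n} - {i}))"
  unfolding near_boundary_def
proof (intro conjI exI[of _ "z i"])
  have "insert (z i) (z ` ({..n} - {i})) = z ` {..n}" using assms(2) by auto
  then show "adjacent (insert (z i) (z ` ({..n} - {i})))" using adjacent_flag[OF assms(1)] by simp
  show "\<forall>l\<ge>N. z i l = 0" using flag_support[OF assms(1,2)] assms(3) by auto
qed (use assms in auto)

text \<open>
  A facet that two simplices of \<open>S\<close> have in common is counted twice. Otherwise the opposite simplex has a
  vertex outside \<open>D\<close>, which makes the facet a face near the boundary, where \<open>d\<close> vanishes.
\<close>

lemma sum_faces_cancel:
  fixes d :: "(nat \<Rightarrow> int) set \<Rightarrow> bit"
  assumes fin: "finite D" and n: "0 < n" "n \<le> N" "i \<le> n" and S: "S \<subseteq> flags_in n D"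
    and closed: "\<And>x. x \<in> S \<Longrightarrow> exchange n i x \<in> flags_in n D \<Longrightarrow> exchange n i x \<in> S"
    and d: "\<And>T. near_boundary N D T \<Longrightarrow> d T = 0"
  shows "(\<Sum>x\<in>S. d (face n i x)) = 0"
proof -
  let ?h = "exchange n i"
  have finS: "finite S" using finite_subset[OF S finite_flags_in[OF fin]] .
  have face: "face n i (?h x) = face n i x" for x by (auto simp: face_def)
  have flag: "flag n x" "\<And>k. k \<le> n \<Longrightarrow> x k \<in> D" if "x \<in> S" for x
    using that S by (auto simp: flags_in_def)
  have "(\<Sum>x\<in>S. d (face n i x)) = (\<Sum>x\<in>{x\<in>S. ?h x \<in> S}. d (face n i x))"
  proof (rule sum.mono_neutral_right[OF finS], goal_cases)
    case 2
    have "d (face n i x) = 0" if x: "x \<in> S" "?h x \<notin> S" for x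
    proof -
      have fl: "flag n (?h x)" by (rule flag_exchange) (use flag(1)[OF x(1)] n in auto)
      have "?h x \<notin> flags_in n D" using closed x by blast
      then obtain k where "k \<le> n" "?h x k \<notin> D" using fl by (auto simp: flags_in_def)
      then have "?h x i \<notin> D" using flag(2)[OF x(1)] by (cases "k = i") auto
      then have "near_boundary N D (face n i (?h x))" unfolding face_def
        by (intro near_boundary_face[OF fl]) (use n flag(2)[OF x(1)] in auto)
      then show ?thesis using d face by simp
    qed
    then show ?case by auto
  qed auto
  also have "\<dots> = 0"
  proof (rule sum_involution_bit[of _ ?h])
    fix x assume x: "x \<in> {x\<in>S. ?h x \<in> S}"
    then show "?h x \<in> {x\<in>S. ?h x \<in> S}" using n by (simp add: exchange_exchange)
    show "?h x \<noteq> x" using exchange_neq[OF flag(1)[of x], of i] x n by auto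
  qed (use finS n in \<open>auto simp: exchange_exchange face\<close>)
  finally show ?thesis .
qed

text \<open>
  Stokes' theorem modulo 2 for the upper half of the region described by \<open>D\<close>: up to faces near the boundary of the
  region, its boundary consists of the simplices of the hyperplane where the last coordinate is
  zero. Such a simplex is a facet of exactly one simplex of the half space, whose top
  vertex is obtained by raising that coordinate to \<open>1\<close>.
\<close>

lemma sum_half_flags_faces:
  fixes d :: "(nat \<Rightarrow> int) set \<Rightarrow> bit"
  assumes fin: "finite D" and m: "Suc m \<le> N"
    and d: "\<And>T. near_boundary N D T \<Longrightarrow> d T = 0"
  shows "(\<Sum>x\<in>half_flags (Suc m) D. \<Sum>i\<le>Suc m. d (face (Suc m) i x)) =
         (\<Sum>x\<in>flags_in m D. d (x ` {..m}))"
proof -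
  let ?n = "Suc m" and ?H = "half_flags (Suc m) D"
  have finH: "finite ?H" using finite_flags_in[OF fin] by (auto simp: half_flags_def)
  have inner: "(\<Sum>x\<in>?H. d (face ?n i x)) = 0" if "i \<le> m" for i
    by (rule sum_faces_cancel[OF fin _ m _ _ _ d]) (use that in \<open>auto simp: half_flags_def\<close>)
  \<comment> \<open>Where the last coordinate of \<open>x m\<close> is not zero, exchanging the top vertex does not change the sign of that coordinate.\<close>
  have outer: "(\<Sum>x\<in>{x \<in> ?H. x m m \<noteq> 0}. d (face ?n ?n x)) = 0"
  proof (rule sum_faces_cancel[OF fin _ m _ _ _ d])
    fix x assume x: "x \<in> {x \<in> ?H. x m m \<noteq> 0}" and h: "exchange ?n ?n x \<in> flags_in ?n D"
    have fl: "flag ?n x" using x by (auto simp: half_flags_def flags_in_def)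
    have pos: "0 < x ?n m" "x m m \<noteq> 0" using x by (auto simp: half_flags_def)
    have odd: "odd (x ?n m)" using flag_top_odd[OF fl] by auto
    have "0 < 2 * x m m - x ?n m"
      using flag_coordinate_cases[OF fl, of m ?n m] pos odd by auto
    then show "exchange ?n ?n x \<in> {x \<in> ?H. x m m \<noteq> 0}" using h pos by (simp add: half_flags_def exchange_def)
  qed (auto simp: half_flags_def)
  define ext where "ext = (\<lambda>y :: nat \<Rightarrow> nat \<Rightarrow> int. y(?n := (y m)(m := 1)))"
  have flag_ext: "flag ?n (ext y)" if y: "flag m y" for y
  proof -
    have ym: "y m m = 0" using flag_support[OF y] by simp
    have "cell_step (y m) ((y m)(m := 1))" unfolding cell_step_def
      by (rule exI[of _ m]) (use ym in auto)
    then show ?thesis using y by (auto simp: flag_def ext_def less_Suc_eq)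
  qed
  have bottom: "(\<Sum>x\<in>{x \<in> ?H. x m m = 0}. d (face ?n ?n x)) = (\<Sum>y\<in>{y \<in> flags_in m D. ext y ?n \<in> D}. d (y ` {..m}))"
  proof (rule sum.reindex_bij_witness[of _ ext "\<lambda>x. x(?n := \<lambda>_. 0)"], goal_cases)
    case (1 x)
    then have fl: "flag ?n x" and pos: "0 < x ?n m" and z: "x m m = 0"
      by (auto simp: half_flags_def flags_in_def)
    obtain l s where l: "even (x m l)" "s \<in> {-1, 1}" "x ?n = (x m)(l := x m l + s)"
      using flag_stepE[OF fl, of m] by auto
    have "l = m" using l z pos by (cases "l = m") auto
    then have "x ?n = (x m)(m := 1)" using l z pos by auto
    then show ?case by (auto simp: ext_def fun_eq_iff)
  next
    case (2 x)
    then have fl: "flag ?n x" and pos: "0 < x ?n m" and z: "x m m = 0" and D: "\<forall>i\<le>?n. x i \<in> D"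
      by (auto simp: half_flags_def flags_in_def)
    have e: "ext (x(?n := \<lambda>_. 0)) = x"
    proof -
      obtain l s where l: "even (x m l)" "s \<in> {-1, 1}" "x ?n = (x m)(l := x m l + s)"
        using flag_stepE[OF fl, of m] by auto
      have "l = m" using l z pos by (cases "l = m") auto
      then have "x ?n = (x m)(m := 1)" using l z pos by auto
      then show ?thesis by (auto simp: ext_def fun_eq_iff)
    qed
    have "x i l = 0" if "i \<le> m" "m \<le> l" for i l
    proof (cases "l = m")
      case True
      then show ?thesis using flag_coordinate_cases[OF fl that(1), of m] z by auto
    next
      case False
      then show ?thesis using flag_support[OF fl, of i l] that by auto
    qed
    then have "flag m (x(?n := \<lambda>_. 0))" using fl by (auto simp: flag_def)
    then show ?case using D e by (auto simp: flags_in_def)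
  next
    case (3 y)
    then show ?case using flag_beyond[of m y] by (auto simp: ext_def flags_in_def fun_eq_iff)
  next
    case (4 y)
    then have y: "flag m y" "\<forall>i\<le>m. y i \<in> D" "ext y ?n \<in> D" by (auto simp: flags_in_def)
    have "ext y m m = 0" using flag_support[OF y(1)] by (simp add: ext_def)
    moreover have "ext y i \<in> D" if "i \<le> ?n" for i
      using y that by (cases "i = ?n") (auto simp: ext_def)
    ultimately show ?case using flag_ext[OF y(1)] by (auto simp: half_flags_def flags_in_def ext_def)
  next
    case (5 x)
    have "{..?n} - {?n} = {..m}" by auto
    then show ?case by (auto simp: face_def intro!: arg_cong[of _ _ d])
  qed
  have rest: "(\<Sum>y\<in>{y \<in> flags_in m D. ext y ?n \<in> D}. d (y ` {..m})) = (\<Sum>y\<in>flags_in m D. d (y ` {..m}))"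
  proof (rule sum.mono_neutral_left[OF finite_flags_in[OF fin]], goal_cases)
    case 2
    have "d (y ` {..m}) = 0" if y: "y \<in> flags_in m D" "ext y ?n \<notin> D" for y
    proof -
      have "flag ?n (ext y)" using y flag_ext by (auto simp: flags_in_def)
      then have "near_boundary N D (ext y ` ({..?n} - {?n}))"
        by (rule near_boundary_face) (use y m in \<open>auto simp: flags_in_def ext_def\<close>)
      moreover have "ext y ` ({..?n} - {?n}) = y ` {..m}" 
        by (rule image_cong) (auto simp: ext_def)
      ultimately show ?thesis using d by simp
    qed
    then show ?case by auto
  qed auto
  have "(\<Sum>x\<in>?H. \<Sum>i\<le>?n. d (face ?n i x)) = (\<Sum>i\<le>?n. \<Sum>x\<in>?H. d (face ?n i x))"
    by (rule sum.swap)
  also have "\<dots> = (\<Sum>x\<in>?H. d (face ?n ?n x))" using inner by simp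
  also have "\<dots> = (\<Sum>x\<in>{x \<in> ?H. x m m = 0} \<union> {x \<in> ?H. x m m \<noteq> 0}. d (face ?n ?n x))"
    by (rule sum.cong) auto
  also have "\<dots> = (\<Sum>x\<in>{x \<in> ?H. x m m = 0}. d (face ?n ?n x)) +
      (\<Sum>x\<in>{x \<in> ?H. x m m \<noteq> 0}. d (face ?n ?n x))"
    using finH by (intro sum.union_disjoint) auto
  also have "\<dots> = (\<Sum>y\<in>flags_in m D. d (y ` {..m}))"
    unfolding outer bottom rest by (rule add_0_right)
  finally show ?thesis .
qed

section \<open>A lattice version of the Borsuk-Ulam theorem\<close>

text \<open>
  The boundary of a boundary is zero.
\<close>

lemma sum_delete_two_bit:
  fixes a :: "'a set \<Rightarrow> bit"
  assumes "finite F"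
  shows "(\<Sum>u\<in>F. \<Sum>v\<in>F - {u}. a (F - {u} - {v})) = 0"
proof -
  have "(\<Sum>u\<in>F. \<Sum>v\<in>F - {u}. a (F - {u} - {v})) =
      (\<Sum>(u, v)\<in>Sigma F (\<lambda>u. F - {u}). a (F - {u} - {v}))"
    using assms by (intro sum.Sigma) auto
  also have "\<dots> = 0"
    by (rule sum_involution_bit[of _ prod.swap]) (use assms in \<open>auto intro!: arg_cong[of _ _ a]\<close>)
  finally show ?thesis .
qed

lemma sum_flags_in_uminus:
  fixes f :: "(nat \<Rightarrow> nat \<Rightarrow> int) \<Rightarrow> bit"
  assumes fin: "finite D" and sym: "\<And>u. u \<in> D \<Longrightarrow> (\<lambda>l. - u l) \<in> D" and "0 < n"
  shows "(\<Sum>x\<in>flags_in n D. f x) = (\<Sum>x\<in>half_flags n D. f x + f (\<lambda>i l. - x i l))"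
proof -
  let ?L = "{x \<in> flags_in n D. x n (n - 1) < 0}"
  have neg: "(\<lambda>i l. - x i l) \<in> flags_in n D" if "x \<in> flags_in n D" for x
    using that sym flag_uminus by (auto simp: flags_in_def)
  have "x n (n - 1) \<noteq> 0" if "x \<in> flags_in n D" for x
  proof -
    have "odd (x n (n - 1))"
      using that flag_top_odd[of n x] \<open>0 < n\<close> by (auto simp: flags_in_def)
    then show ?thesis by auto
  qed
  then have "flags_in n D = half_flags n D \<union> ?L" by (force simp: half_flags_def)
  then have "(\<Sum>x\<in>flags_in n D. f x) = (\<Sum>x\<in>half_flags n D \<union> ?L. f x)" by simp
  also have "\<dots> = (\<Sum>x\<in>half_flags n D. f x) + (\<Sum>x\<in>?L. f x)"
    using finite_flags_in[OF fin] by (intro sum.union_disjoint) (auto simp: half_flags_def)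
  also have "(\<Sum>x\<in>?L. f x) = (\<Sum>x\<in>half_flags n D. f (\<lambda>i l. - x i l))"
    by (rule sum.reindex_bij_witness[of _ "\<lambda>x i l. - x i l" "\<lambda>x i l. - x i l"])
      (use neg in \<open>auto simp: half_flags_def\<close>)
  finally show ?thesis by (simp add: sum.distrib)
qed

lemma face_eq_delete: "flag n x \<Longrightarrow> i \<le> n \<Longrightarrow> face n i x = x ` {..n} - {x i}"
  using inj_on_image_set_diff[OF inj_on_flag, of n x "{..n}" "{i}"] by (simp add: face_def)

lemma sum_faces_eq: 
  assumes "flag n x"
  shows "(\<Sum>i\<le>n. a (face n i x)) = (\<Sum>v\<in>x ` {..n}. a (x ` {..n} - {v}))"
  using face_eq_delete[OF assms] by (simp add: sum.reindex[OF inj_on_flag[OF assms]])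

lemma flags_in_0:
  assumes "(\<lambda>_. 0) \<in> D"
  shows "flags_in 0 D = {\<lambda>_ _. 0}"
proof
  show "flags_in 0 D \<subseteq> {\<lambda>_ _. 0}"
  proof
    fix x assume "x \<in> flags_in 0 D"
    then have fl: "flag 0 x" by (simp add: flags_in_def)
    have "x i = (\<lambda>_. 0)" for i
      using flag_support[OF fl, of i] flag_beyond[OF fl, of i] by (cases i) auto
    then have "x = (\<lambda>_ _. 0)" by (rule ext)
    then show "x \<in> {\<lambda>_ _. 0}" by simp
  qed
  show "{\<lambda>_ _. 0} \<subseteq> flags_in 0 D" using assms by (simp add: flags_in_def flag_def)
qed

text \<open>
  Suppose that near the boundary of \<open>D\<close> the labels are odd, never opposite on adjacent points, and have
  fewer than \<open>n\<close> indices. Let \<open>S m\<close> be the number modulo 2 of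
  alternating facets, summed over the \<open>m\<close>-dimensional simplices of \<open>D\<close> in the first \<open>m\<close> coordinates. Antipodal simplices
  can be combined, so \<open>S (Suc m)\<close> is a sum over the upper half space of a function that is
  symmetric under sign change. By Fan's identity this function is, near the boundary of \<open>D\<close>, the
  coboundary of the alternating cochain, and \<open>sum_half_flags_faces\<close> moves the count to the
  hyperplane. This gives \<open>S (Suc m) = S m\<close>. But \<open>S 0 = 1\<close>, whereas \<open>S n = 0\<close> for lack of label indices.
\<close>

theorem lattice_borsuk:
  fixes \<l> :: "(nat \<Rightarrow> int) \<Rightarrow> nat"
  assumes fin: "finite D" and sym: "\<And>u. u \<in> D \<Longrightarrow> (\<lambda>l. - u l) \<in> D" and zero: "(\<lambda>_. 0) \<in> D"
    and "k < n"
  obtains T u v where "near_boundary n D T" "u \<in> T" "v \<in> T"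
    "k \<le> \<l> u div 2 \<or> \<l> (\<lambda>l. - u l) \<noteq> flip (\<l> u) \<or> \<l> u = flip (\<l> v)"
proof (rule ccontr)
  assume "\<not> thesis"
  with that have labels: "\<l> u div 2 < k" and odd: "\<l> (\<lambda>l. - u l) = flip (\<l> u)"
    and cf: "\<l> u \<noteq> flip (\<l> v)" if "near_boundary n D T" "u \<in> T" "v \<in> T" for T u v
    using that by (meson not_le)+
  define neg where "neg = (\<lambda>(u :: nat \<Rightarrow> int) l. - u l)"
  have inj_neg: "inj_on neg T" for T by (auto simp: neg_def inj_on_def fun_eq_iff)
  define A where "A T = alternating (image_mset \<l> (mset_set T))" for T
  define B where "B T = A T + A (neg ` T)" for T
  define \<delta> where "\<delta> T = (\<Sum>v\<in>T. A (T - {v}))" for T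
  \<comment> \<open>Fan's identity, where oddness of the labels turns flipped labels into labels of antipodal points.\<close>
  have B_eq_\<delta>: "B T = \<delta> T" if nb: "near_boundary n D T" for T
  proof -
    have finT: "finite T" using nb by (simp add: near_boundary_def)
    let ?L = "image_mset \<l> (mset_set T)"
    have "\<delta> T = (\<Sum>v\<in>T. alternating (?L - {#\<l> v#}))"
      unfolding \<delta>_def A_def using finT
      by (intro sum.cong refl arg_cong[of _ _ alternating])
        (simp add: mset_set_Diff image_mset_Diff)
    also have "\<dots> = (\<Sum>c\<in>#?L. alternating (?L - {#c#}))"
      by (simp add: sum_unfold_sum_mset image_mset.compositionality comp_def)
    also have "\<dots> = alternating ?L + alternating (image_mset flip ?L)"
      by (rule sum_alternating_delete) (use cf[OF nb] finT in auto)
    also have "image_mset flip ?L = image_mset \<l> (mset_set (neg ` T))"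
    proof -
      have "image_mset flip ?L = image_mset (\<lambda>u. \<l> (neg u)) (mset_set T)"
        unfolding image_mset.compositionality comp_def
        by (rule image_mset_cong) (use odd[OF nb] finT in \<open>auto simp: neg_def\<close>)
      also have "\<dots> = image_mset \<l> (image_mset neg (mset_set T))"
        by (simp add: image_mset.compositionality comp_def)
      also have "image_mset neg (mset_set T) = mset_set (neg ` T)"
        by (rule image_mset_mset_set[OF inj_neg])
      finally show ?thesis .
    qed
    finally show ?thesis by (simp add: B_def A_def)
  qed
  have B_vanishes: "B T = 0" if nb: "near_boundary n D T" and card: "card T = n" for T
  proof -
    have T: "finite T" "T \<subseteq> D" using nb by (auto simp: near_boundary_def)
    have "A T = 0" unfolding A_def
      by (rule alternating_eq_0[of _ k]) (use cf[OF nb] labels[OF nb] T card \<open>k < n\<close> in auto)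
    moreover have "A (neg ` T) = 0" unfolding A_def
    proof (rule alternating_eq_0[of _ k], goal_cases)
      case (1 c d)
      then obtain u v where uv: "u \<in> T" "v \<in> T" "c = \<l> (neg u)" "d = \<l> (neg v)"
        using T by auto
      have "c = flip (\<l> u)" "d = flip (\<l> v)" "\<l> u \<noteq> flip (\<l> v)"
        using uv odd[OF nb] cf[OF nb] by (auto simp: neg_def)
      then show ?case by (metis flip_flip)
    next
      case (2 c)
      then show ?case using T labels[OF nb] odd[OF nb] by (auto simp: neg_def flip_div_2)
    next
      case 3
      then show ?case using card \<open>k < n\<close> card_image[OF inj_neg] by simp
    qed
    ultimately show ?thesis by (simp add: B_def)
  qed
  define S where "S m = (\<Sum>x\<in>flags_in m D. \<Sum>i\<le>m. A (face m i x))" for m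
  have face_neg: "face m i (\<lambda>i l. - x i l) = neg ` face m i x" for m i x
    by (auto simp: face_def neg_def)
  have S_half: "S (Suc m) = (\<Sum>x\<in>half_flags (Suc m) D. \<Sum>i\<le>Suc m. B (face (Suc m) i x))" for m
  proof -
    have "S (Suc m) = (\<Sum>x\<in>half_flags (Suc m) D. (\<Sum>i\<le>Suc m. A (face (Suc m) i x)) +
        (\<Sum>i\<le>Suc m. A (face (Suc m) i (\<lambda>i l. - x i l))))"
      unfolding S_def by (rule sum_flags_in_uminus[OF fin sym]) auto
    then show ?thesis by (simp only: B_def face_neg sum.distrib)
  qed
  have flagD: "flag m x" if "x \<in> flags_in m D \<or> x \<in> half_flags m D" for m x
    using that by (auto simp: flags_in_def half_flags_def)
  \<comment> \<open>The function \<open>B\<close> is symmetric, so antipodal simplices cancel; only for \<open>m = 0\<close> is the simplex its own antipode.\<close>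
  have sum_B: "(\<Sum>x\<in>flags_in m D. B (x ` {..m})) = 0" for m
  proof (cases m)
    case 0
    show ?thesis unfolding 0 flags_in_0[OF zero] by (simp add: B_def neg_def)
  next
    case (Suc m')
    have B_neg: "B ((\<lambda>i l. - x i l) ` {..m}) = B (x ` {..m})" for x :: "nat \<Rightarrow> nat \<Rightarrow> int"
    proof -
      have "(\<lambda>i l. - x i l) ` {..m} = neg ` x ` {..m}" "neg ` neg ` x ` {..m} = x ` {..m}"
        by (auto simp: neg_def image_image)
      then show ?thesis by (simp add: B_def add.commute)
    qed
    have "(\<Sum>x\<in>flags_in m D. B (x ` {..m})) =
       (\<Sum>x\<in>half_flags m D. B (x ` {..m}) + B ((\<lambda>i l. - x i l) ` {..m}))"
      by (rule sum_flags_in_uminus[OF fin sym]) (use Suc in auto)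
    also have "\<dots> = 0" by (simp only: B_neg bit_double sum.neutral_const)
    finally show ?thesis .
  qed
  have "S m = 1" if "m \<le> n" for m
    using that
  proof (induction m)
    case 0
    show ?case unfolding S_def flags_in_0[OF zero] by (simp add: face_def A_def alternating_def)
  next
    case (Suc m)
    \<comment> \<open>Modulo 2 the sum of \<open>B\<close> and \<open>\<delta>\<close> is their difference, which vanishes near the boundary.\<close>
    define d where "d T = B T + \<delta> T" for T
    have "(\<Sum>x\<in>half_flags (Suc m) D. \<Sum>i\<le>Suc m. d (face (Suc m) i x)) =
        (\<Sum>x\<in>flags_in m D. d (x ` {..m}))"
      by (rule sum_half_flags_faces[OF fin Suc.prems]) (simp add: d_def B_eq_\<delta>)
    moreover have "(\<Sum>i\<le>Suc m. \<delta> (face (Suc m) i x)) = 0" if "x \<in> half_flags (Suc m) D" for x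
    proof -
      have fl: "flag (Suc m) x" using that flagD by blast
      show ?thesis unfolding sum_faces_eq[OF fl, of \<delta>] unfolding \<delta>_def
        by (rule sum_delete_two_bit) simp
    qed
    moreover note sum_B[of m]
    moreover have "(\<Sum>x\<in>flags_in m D. \<delta> (x ` {..m})) = S m"
      unfolding S_def by (rule sum.cong) (auto simp: sum_faces_eq flagD \<delta>_def)
    ultimately have "S (Suc m) = S m"
      unfolding S_half d_def by (simp add: sum.distrib del: sum.atMost_Suc)
    then show ?case using Suc by simp
  qed
  then have "S n = 1" by simp
  moreover have "S n = 0"
  proof -
    obtain m where m: "n = Suc m" using \<open>k < n\<close> by (cases n) auto
    \<comment> \<open>Only faces with \<open>n\<close> vertices have to carry more labels than there are indices.\<close>
    define d where "d T = (if card T = n then B T else 0)" for T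
    have "d (face (Suc m) i x) = B (face (Suc m) i x)"
      if "x \<in> half_flags (Suc m) D" "i \<le> Suc m" for x i
    proof -
      have "card (face (Suc m) i x) = n"
        unfolding face_def using inj_on_flag[of "Suc m" x] flagD that m
        by (subst card_image) (auto intro: inj_on_subset)
      then show ?thesis by (simp add: d_def)
    qed
    then have "S n = (\<Sum>x\<in>half_flags (Suc m) D. \<Sum>i\<le>Suc m. d (face (Suc m) i x))"
      unfolding m S_half by (intro sum.cong refl) auto
    also have "\<dots> = (\<Sum>x\<in>flags_in m D. d (x ` {..m}))"
      by (rule sum_half_flags_faces[OF fin, of m n]) (auto simp: d_def B_vanishes m)
    also have "\<dots> = (\<Sum>x\<in>flags_in m D. B (x ` {..m}))"
      by (intro sum.cong refl) (use card_image[OF inj_on_flag[of m]] flagD m in \<open>simp add: d_def\<close>)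
    also have "\<dots> = 0" by (rule sum_B)
    finally show ?thesis .
  qed
  ultimately show False by simp
qed

section \<open>Bounded coordinates in finite dimension and codimension\<close>

text \<open>
  The box is the continuous image of a product of intervals, built up one vector at a time.
\<close>

lemma compact_coordinate_box:
  fixes f :: "'i \<Rightarrow> 'x::real_normed_vector"
  assumes "finite I"
  shows "compact {\<Sum>i\<in>I. c i *\<^sub>R f i | c. \<forall>i\<in>I. \<bar>c i\<bar> \<le> r}"
  using assms
proof (induction I)
  case empty
  have "{\<Sum>i\<in>{}. c i *\<^sub>R f i | c. \<forall>i\<in>{}. \<bar>c i\<bar> \<le> r} = {0}" by auto
  then show ?case by simp
next
  case (insert j I)
  let ?K = "{\<Sum>i\<in>I. c i *\<^sub>R f i | c. \<forall>i\<in>I. \<bar>c i\<bar> \<le> r}"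
  have "{\<Sum>i\<in>insert j I. c i *\<^sub>R f i | c. \<forall>i\<in>insert j I. \<bar>c i\<bar> \<le> r} =
      (\<lambda>(t, x). t *\<^sub>R f j + x) ` ({-r..r} \<times> ?K)" (is "?L = ?R")
  proof
    show "?L \<subseteq> ?R"
    proof
      fix x assume "x \<in> ?L"
      then obtain c where c: "x = (\<Sum>i\<in>insert j I. c i *\<^sub>R f i)" "\<forall>i\<in>insert j I. \<bar>c i\<bar> \<le> r" by blast
      then have "x = (\<lambda>(t, x). t *\<^sub>R f j + x) (c j, \<Sum>i\<in>I. c i *\<^sub>R f i)" using insert.hyps by simp
      moreover have "(c j, \<Sum>i\<in>I. c i *\<^sub>R f i) \<in> {-r..r} \<times> ?K" using c by (auto simp: abs_le_iff)
      ultimately show "x \<in> ?R" by blast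
    qed
    show "?R \<subseteq> ?L"
    proof
      fix x assume "x \<in> ?R"
      then obtain t c where c: "x = t *\<^sub>R f j + (\<Sum>i\<in>I. c i *\<^sub>R f i)" "\<forall>i\<in>I. \<bar>c i\<bar> \<le> r" "t \<in> {-r..r}" by auto
      have "(\<Sum>i\<in>insert j I. (c(j := t)) i *\<^sub>R f i) = t *\<^sub>R f j + (\<Sum>i\<in>I. (c(j := t)) i *\<^sub>R f i)"
        using insert.hyps by simp
      also have "(\<Sum>i\<in>I. (c(j := t)) i *\<^sub>R f i) = (\<Sum>i\<in>I. c i *\<^sub>R f i)"
        using insert.hyps by (intro sum.cong) auto
      finally have "x = (\<Sum>i\<in>insert j I. (c(j := t)) i *\<^sub>R f i)" using c by simp
      moreover have "\<forall>i\<in>insert j I. \<bar>(c(j := t)) i\<bar> \<le> r" using c by auto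
      ultimately show "x \<in> ?L" by blast
    qed
  qed
  moreover have "compact ({-r..r} \<times> ?K)" using insert.IH by (intro compact_Times) auto
  moreover have "continuous_on ({-r..r} \<times> ?K) (\<lambda>(t, x). t *\<^sub>R f j + x)"
    unfolding case_prod_beta by (intro continuous_intros)
  ultimately show ?case by (simp only: compact_continuous_image)
qed

text \<open>
  Scaling the largest coefficient \<open>c j\<close> to \<open>1\<close> turns \<open>z + (\<Sum>i\<in>I. c i *\<^sub>R f i)\<close> into an element of the sum of the closed subspace \<open>Z\<close>
  and a compact set. This sum is closed, and it does not contain \<open>0\<close> by independence modulo
  \<open>Z\<close>, so it keeps a positive distance from \<open>0\<close>. The case \<open>Z = {0}\<close> compares norms on a
  finite-dimensional space; for general \<open>Z\<close> it gives continuous coordinates on the quotient.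
\<close>

lemma coordinates_bound:
  fixes f :: "'i \<Rightarrow> 'x::real_normed_vector"
  assumes "finite I" and Z: "closed Z" "subspace Z"
    and indep: "\<And>c. (\<Sum>i\<in>I. c i *\<^sub>R f i) \<in> Z \<Longrightarrow> \<forall>i\<in>I. c i = 0"
  shows "\<exists>C\<ge>0. \<forall>c. \<forall>z\<in>Z. \<forall>i\<in>I. \<bar>c i\<bar> \<le> C * norm (z + (\<Sum>i\<in>I. c i *\<^sub>R f i))"
proof -
  define K where "K j = {\<Sum>i\<in>I - {j}. c i *\<^sub>R f i | c. \<forall>i\<in>I - {j}. \<bar>c i\<bar> \<le> 1}" for j
  \<comment> \<open>The vectors with coefficient \<open>1\<close> at \<open>f j\<close> and all others at most \<open>1\<close> in absolute value.\<close>
  define S where "S j = (\<Union>z\<in>Z. \<Union>y\<in>(+) (f j) ` K j. {z + y})" for j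
  have "\<exists>\<delta>>0. \<forall>x\<in>S j. \<delta> \<le> norm x" if j: "j \<in> I" for j
  proof -
    have "compact ((+) (f j) ` K j)"
      unfolding K_def using \<open>finite I\<close> by (intro compact_translation compact_coordinate_box) auto
    then have "closed (S j)" unfolding S_def by (rule closed_compact_sums[OF Z(1)])
    moreover have "0 \<notin> S j"
    proof
      assume "0 \<in> S j"
      then obtain z c where z: "z \<in> Z" "0 = z + (f j + (\<Sum>i\<in>I - {j}. c i *\<^sub>R f i))"
        by (auto simp: S_def K_def)
      have "(\<Sum>i\<in>I. (c(j := 1)) i *\<^sub>R f i) = f j + (\<Sum>i\<in>I - {j}. (c(j := 1)) i *\<^sub>R f i)"
        using j \<open>finite I\<close> by (subst sum.remove[of _ j]) auto
      also have "(\<Sum>i\<in>I - {j}. (c(j := 1)) i *\<^sub>R f i) = (\<Sum>i\<in>I - {j}. c i *\<^sub>R f i)"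
        by (intro sum.cong) auto
      finally have "(\<Sum>i\<in>I. (c(j := 1)) i *\<^sub>R f i) = - z" using z(2) by (metis add.inverse_unique)
      then have "(\<Sum>i\<in>I. (c(j := 1)) i *\<^sub>R f i) \<in> Z" using z(1) Z(2) by (simp add: subspace_neg)
      from indep[OF this] j show False by auto
    qed
    ultimately have "open (- S j)" "0 \<in> - S j" by auto
    then obtain \<delta> where "\<delta> > 0" "ball 0 \<delta> \<subseteq> - S j" using open_contains_ball by blast
    then show ?thesis by (intro exI[of _ \<delta>]) (force simp: not_le[symmetric])
  qed
  then obtain \<delta> where \<delta>: "\<And>j. j \<in> I \<Longrightarrow> \<delta> j > 0" "\<And>j x. j \<in> I \<Longrightarrow> x \<in> S j \<Longrightarrow> \<delta> j \<le> norm x" by metis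
  show ?thesis
  proof (intro exI[of _ "\<Sum>j\<in>I. 1 / \<delta> j"] conjI allI ballI)
    show "0 \<le> (\<Sum>j\<in>I. 1 / \<delta> j)" using \<delta>(1) by (intro sum_nonneg) (simp add: less_imp_le)
    fix c z i assume z: "z \<in> Z" and i: "i \<in> I"
    let ?x = "z + (\<Sum>i\<in>I. c i *\<^sub>R f i)"
    obtain j where j: "j \<in> I" "\<And>i. i \<in> I \<Longrightarrow> \<bar>c i\<bar> \<le> \<bar>c j\<bar>"
    proof -
      let ?m = "Max ((\<lambda>i. \<bar>c i\<bar>) ` I)"
      have "?m \<in> (\<lambda>i. \<bar>c i\<bar>) ` I" using \<open>finite I\<close> i by (intro Max_in) auto
      then obtain j where "j \<in> I" "\<bar>c j\<bar> = ?m" by auto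
      then show thesis using that \<open>finite I\<close> by (metis Max_ge finite_imageI imageI)
    qed
    show "\<bar>c i\<bar> \<le> (\<Sum>j\<in>I. 1 / \<delta> j) * norm ?x"
    proof (cases "c j = 0")
      case True
      then show ?thesis using j(2)[OF i] \<open>0 \<le> (\<Sum>j\<in>I. 1 / \<delta> j)\<close> by simp
    next
      case False
      have "(1 / c j) *\<^sub>R ?x = (1 / c j) *\<^sub>R z + (f j + (\<Sum>i\<in>I - {j}. (c i / c j) *\<^sub>R f i))"
        using False j(1) \<open>finite I\<close>
        by (simp add: sum.remove[of I j] scaleR_right_distrib scaleR_sum_right)
      moreover have "(1 / c j) *\<^sub>R z \<in> Z" using z Z(2) by (simp add: subspace_scale)
      moreover have "(\<Sum>i\<in>I - {j}. (c i / c j) *\<^sub>R f i) \<in> K j"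
        unfolding K_def using j(2) False by (intro CollectI exI[of _ "\<lambda>i. c i / c j"]) auto
      ultimately have "(1 / c j) *\<^sub>R ?x \<in> S j" unfolding S_def by blast
      then have "\<delta> j \<le> norm ((1 / c j) *\<^sub>R ?x)" by (rule \<delta>(2)[OF j(1)])
      also have "\<dots> = norm ?x / \<bar>c j\<bar>" unfolding norm_scaleR by simp
      finally have "\<bar>c j\<bar> \<le> 1 / \<delta> j * norm ?x"
        using False \<delta>(1)[OF j(1)] by (simp add: field_simps)
      also have "\<dots> \<le> (\<Sum>j\<in>I. 1 / \<delta> j) * norm ?x"
        using \<delta>(1) j(1) \<open>finite I\<close>
        by (intro mult_right_mono member_le_sum) (auto simp: less_imp_le)
      finally show ?thesis using j(2)[OF i] by linarith
    qed
  qed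
qed

lemma coordinates_norm_bound:
  fixes b :: "nat \<Rightarrow> 'x::real_normed_vector"
  assumes "\<And>c. (\<Sum>i<n. c i *\<^sub>R b i) = 0 \<Longrightarrow> \<forall>i<n. c i = 0"
  shows "\<exists>C\<ge>0. \<forall>c. \<forall>i<n. \<bar>c i\<bar> \<le> C * norm (\<Sum>i<n. c i *\<^sub>R b i)"
proof -
  have "\<exists>C\<ge>0. \<forall>c. \<forall>z\<in>{0}. \<forall>i\<in>{..<n}. \<bar>c i\<bar> \<le> C * norm (z + (\<Sum>i<n. c i *\<^sub>R b i))"
    by (rule coordinates_bound) (use assms in auto)
  then show ?thesis by (simp add: Ball_def)
qed

lemma span_image_coordinates:
  fixes b :: "'i \<Rightarrow> 'x::real_vector"
  assumes "finite I"
  shows "span (b ` I) = {\<Sum>i\<in>I. c i *\<^sub>R b i | c. True}"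
proof -
  have "\<exists>c. x = (\<Sum>i\<in>I. c i *\<^sub>R b i)" if "x \<in> span (b ` I)" for x
    using that
  proof (induction rule: span_induct_alt)
    case base
    show ?case by (intro exI[of _ "\<lambda>_. 0"]) simp
  next
    case (step a x y)
    then obtain j c where j: "j \<in> I" "x = b j" "y = (\<Sum>i\<in>I. c i *\<^sub>R b i)" by auto
    have "a *\<^sub>R x + y = (\<Sum>i\<in>I. ((if i = j then a else 0) + c i) *\<^sub>R b i)"
      using j assms by (simp add: scaleR_add_left sum.distrib if_distrib[of "\<lambda>t. t *\<^sub>R _"] cong: if_cong)
    then show ?case by (rule exI[of _ "\<lambda>i. (if i = j then a else 0) + c i"])
  qed
  then show ?thesis by (auto intro!: span_sum intro: span_scale span_base)
qed

lemma compact_span_Int_cball: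
  fixes b :: "nat \<Rightarrow> 'x::real_normed_vector"
  assumes indep: "\<And>c. (\<Sum>i<n. c i *\<^sub>R b i) = 0 \<Longrightarrow> \<forall>i<n. c i = 0"
  shows "compact (span (b ` {..<n}) \<inter> cball 0 r)"
proof -
  define K where "K s = {\<Sum>i<n. c i *\<^sub>R b i | c. \<forall>i\<in>{..<n}. \<bar>c i\<bar> \<le> s}" for s
  have K_span: "K s \<subseteq> span (b ` {..<n})" for s
    by (auto simp: K_def intro!: span_sum intro: span_scale span_base)
  obtain C where C: "C \<ge> 0" "\<forall>c. \<forall>i<n. \<bar>c i\<bar> \<le> C * norm (\<Sum>i<n. c i *\<^sub>R b i)"
    using coordinates_norm_bound[OF indep] by blast
  have "x \<in> K (C * r)" if x: "x \<in> span (b ` {..<n})" "norm x \<le> r" for x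
  proof -
    obtain c where c: "x = (\<Sum>i<n. c i *\<^sub>R b i)"
      using x(1) span_image_coordinates[of "{..<n}" b] by auto
    have "\<bar>c i\<bar> \<le> C * r" if "i < n" for i
    proof -
      have "\<bar>c i\<bar> \<le> C * norm x" using C(2)[rule_format, of i c] that c by simp
      also have "\<dots> \<le> C * r" using x(2) C(1) by (intro mult_left_mono) auto
      finally show ?thesis .
    qed
    then show ?thesis unfolding K_def using c by auto
  qed
  then have "span (b ` {..<n}) \<inter> cball 0 r = K (C * r) \<inter> cball 0 r" using K_span by auto
  moreover have "compact (K (C * r))" unfolding K_def by (rule compact_coordinate_box) simp
  ultimately show ?thesis by (simp add: compact_Int_closed)
qed

text \<open>
  The coordinates of the quotient space by \<open>Z\<close> with respect to the basis \<open>B\<close>. They are Lipschitz continuous by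
  \<open>coordinates_bound\<close>, which also yields that they are odd, by applying it to \<open>x + (- x) = 0\<close>.
\<close>

lemma coordinates_modulo_closed_subspace:
  fixes Z B :: "'x::real_normed_vector set"
  assumes Z: "closed Z" "subspace Z" and B: "finite B" "quotient_basis Z B"
  obtains H :: "'x \<Rightarrow> 'x \<Rightarrow> real" where
    "\<And>b. b \<in> B \<Longrightarrow> continuous_on UNIV (H b)" "\<And>b x. b \<in> B \<Longrightarrow> H b (- x) = - H b x"
    "\<And>x. \<forall>b\<in>B. H b x = 0 \<Longrightarrow> x \<in> Z"
proof -
  have indep: "\<forall>b\<in>B. c b = 0" if "(\<Sum>b\<in>B. c b *\<^sub>R b) \<in> Z" for c
  proof -
    have "coset Z (\<Sum>b\<in>B. c b *\<^sub>R b) = coset Z 0"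
      using that by (simp only: coset_eq_iff[OF Z(2)] diff_zero)
    then show ?thesis using B unfolding quotient_basis_def by blast
  qed
  have "\<exists>C\<ge>0. \<forall>c. \<forall>z\<in>Z. \<forall>b\<in>B. \<bar>c b\<bar> \<le> C * norm (z + (\<Sum>b\<in>B. c b *\<^sub>R b))"
    by (rule coordinates_bound[OF B(1) Z]) (rule indep)
  then obtain C where C: "C \<ge> 0"
      "\<forall>c. \<forall>z\<in>Z. \<forall>b\<in>B. \<bar>c b\<bar> \<le> C * norm (z + (\<Sum>b\<in>B. c b *\<^sub>R b))"
    by (elim exE conjE)
  have "\<exists>c. x - (\<Sum>b\<in>B. c b *\<^sub>R b) \<in> Z" for x
  proof -
    from B(2) have "\<exists>T c. finite T \<and> T \<subseteq> B \<and> coset Z x = coset Z (\<Sum>b\<in>T. c b *\<^sub>R b)"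
      unfolding quotient_basis_def by (elim conjE allE)
    then obtain T c where T: "T \<subseteq> B" "coset Z x = coset Z (\<Sum>b\<in>T. c b *\<^sub>R b)"
      by (elim exE conjE)
    have "x - (\<Sum>b\<in>T. c b *\<^sub>R b) \<in> Z" using T(2) by (simp only: coset_eq_iff[OF Z(2)])
    moreover have "(\<Sum>b\<in>T. c b *\<^sub>R b) = (\<Sum>b\<in>B. (if b \<in> T then c b else 0) *\<^sub>R b)"
      using T(1) B(1) by (intro sum.mono_neutral_cong_left) auto
    ultimately have "x - (\<Sum>b\<in>B. (if b \<in> T then c b else 0) *\<^sub>R b) \<in> Z" by simp
    then show ?thesis by (rule exI[of _ "\<lambda>b. if b \<in> T then c b else 0"])
  qed
  then obtain c where c: "\<And>x. x - (\<Sum>b\<in>B. c x b *\<^sub>R b) \<in> Z" by metis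
  have lip: "\<bar>c x b - c y b\<bar> \<le> C * norm (x - y)" if "b \<in> B" for x y b
  proof -
    let ?z = "(x - (\<Sum>b\<in>B. c x b *\<^sub>R b)) - (y - (\<Sum>b\<in>B. c y b *\<^sub>R b))"
    have eq: "?z + (\<Sum>b\<in>B. (c x b - c y b) *\<^sub>R b) = x - y"
      by (simp add: scaleR_diff_left sum_subtractf)
    have "?z \<in> Z" using c Z(2) by (simp only: subspace_diff)
    from C(2)[rule_format, OF this that, of "\<lambda>b. c x b - c y b"] show ?thesis
      unfolding eq .
  qed
  show thesis
  proof
    fix b assume b: "b \<in> B"
    have "C-lipschitz_on UNIV (\<lambda>x. c x b)"
      using lip[OF b] C(1) by (auto intro!: lipschitz_onI simp: dist_norm)
    then show "continuous_on UNIV (\<lambda>x. c x b)" by (rule lipschitz_on_continuous_on)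
    fix x
    let ?z = "(x - (\<Sum>b\<in>B. c x b *\<^sub>R b)) + (- x - (\<Sum>b\<in>B. c (- x) b *\<^sub>R b))"
    have eq: "?z + (\<Sum>b\<in>B. (c x b + c (- x) b) *\<^sub>R b) = 0"
      by (simp add: scaleR_add_left sum.distrib)
    have "?z \<in> Z" using c Z(2) by (simp only: subspace_add)
    from C(2)[rule_format, OF this b, of "\<lambda>b. c x b + c (- x) b"] show "c (- x) b = - c x b"
      unfolding eq by simp
  next
    fix x assume "\<forall>b\<in>B. c x b = 0"
    then show "x \<in> Z" using c[of x] by simp
  qed
qed

lemma codim_less_enatE:
  assumes "subspace Z" "codim Z < enat n"
  obtains B where "finite B" "quotient_basis Z B" "card B < n"
proof -
  have "\<exists>B. finite B \<and> quotient_basis Z B"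
  proof (rule ccontr)
    assume "\<not> ?thesis"
    then have "codim Z = \<infinity>" unfolding codim_def by (simp only: if_False)
    then show False using assms(2) by simp
  qed
  then obtain B where "finite B" "quotient_basis Z B" by blast
  then show thesis using that codim_eq_card[OF assms(1)] assms(2) by fastforce
qed

lemma finite_dim_indexed_basis:
  fixes V :: "'x::real_vector set"
  assumes "\<exists>B. finite B \<and> V = span B"
  shows "\<exists>e. V = span (e ` {..<dim V}) \<and>
    (\<forall>c. (\<Sum>i<dim V. c i *\<^sub>R e i) = 0 \<longrightarrow> (\<forall>i<dim V. c i = 0))"
proof -
  obtain B where B: "finite B" "V = span B" using assms by blast
  obtain A where A: "A \<subseteq> V" "independent A" "V \<subseteq> span A" "card A = dim V"
    using basis_exists[of V] by blast
  have "finite A" using independent_span_bound[OF B(1) A(2)] A(1) B(2) by blast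
  have "V = span A" using A(1,3) B(2) by (metis span_minimal subspace_span subset_antisym)
  obtain e where e: "bij_betw e {..<dim V} A"
    using ex_bij_betw_nat_finite[OF \<open>finite A\<close>] A(4) by (auto simp: atLeast0LessThan)
  then have eA: "e ` {..<dim V} = A" and inj: "inj_on e {..<dim V}" by (auto simp: bij_betw_def)
  show ?thesis
  proof (rule exI[of _ e], rule conjI, goal_cases)
    case 1
    show "V = span (e ` {..<dim V})" using \<open>V = span A\<close> eA by simp
  next
    case 2
    have "\<forall>i<dim V. c i = 0" if c: "(\<Sum>i<dim V. c i *\<^sub>R e i) = 0" for c
    proof -
      have "(\<Sum>v\<in>A. c (the_inv_into {..<dim V} e v) *\<^sub>R v) = (\<Sum>i<dim V. c i *\<^sub>R e i)"
        unfolding eA[symmetric] sum.reindex[OF inj] by (intro sum.cong) (auto simp: the_inv_into_f_f[OF inj])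
      then have "\<forall>v\<in>A. c (the_inv_into {..<dim V} e v) = 0"
        using A(2) c unfolding dependent_finite[OF \<open>finite A\<close>] by metis
      then show ?thesis using eA the_inv_into_f_f[OF inj] by (metis imageI lessThan_iff)
    qed
    then show ?case by blast
  qed
qed

section \<open>Common zeros of odd functions on a boundary\<close>

text \<open>
  The Borsuk-Ulam theorem up to an error \<open>\<epsilon>\<close>. Label each point of a fine grid in \<open>U\<close> with an index
  \<open>j\<close> that maximizes \<open>\<bar>h j\<bar>\<close> and with the sign of \<open>h j\<close>. If oddness of the labels fails at a point, all \<open>h i\<close> vanish there;
  if two adjacent points have opposite labels, the dominating function changes sign between them. In
  both cases the values at the first point are controlled by the variation between the two points.
\<close>

lemma borsuk_grid:
  fixes b :: "nat \<Rightarrow> 'x::real_normed_vector" and h :: "nat \<Rightarrow> 'x \<Rightarrow> real"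
  assumes indep: "\<And>c. (\<Sum>i<n. c i *\<^sub>R b i) = 0 \<Longrightarrow> \<forall>i<n. c i = 0"
    and U: "0 \<in> U" "\<And>x. x \<in> U \<Longrightarrow> - x \<in> U" "bounded (U \<inter> span (b ` {..<n}))"
    and "k < n" and odd: "\<And>i x. i < k \<Longrightarrow> h i (- x) = - h i x" and "\<epsilon> > 0"
  shows "\<exists>x y w. x \<in> span (b ` {..<n}) \<and> x \<in> U \<and> w \<notin> U \<and>
    norm (y - x) \<le> \<epsilon> \<and> norm (w - x) \<le> \<epsilon> \<and>
    (\<forall>i<k. \<bar>h i x\<bar> \<le> (\<Sum>j<k. \<bar>h j x - h j y\<bar>))"
proof -
  have sum_pos: "0 < 1 + (\<Sum>i<n. norm (b i))" by (intro add_pos_nonneg sum_nonneg) auto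
  \<comment> \<open>The scaled lattice step that keeps adjacent grid points at distance at most \<open>\<epsilon>\<close>.\<close>
  define e where "e = \<epsilon> / (1 + (\<Sum>i<n. norm (b i)))"
  have e: "e > 0" "e * (\<Sum>i<n. norm (b i)) \<le> \<epsilon>"
    using sum_pos \<open>\<epsilon> > 0\<close> by (auto simp: e_def field_simps)
  define \<Phi> where "\<Phi> z = (\<Sum>i<n. (e * of_int (z i)) *\<^sub>R b i)" for z :: "nat \<Rightarrow> int"
  have \<Phi>_span: "\<Phi> z \<in> span (b ` {..<n})" for z
    unfolding \<Phi>_def by (intro span_sum span_scale span_base) auto
  have \<Phi>_minus: "\<Phi> (\<lambda>l. - z l) = - \<Phi> z" for z
    by (simp add: \<Phi>_def sum_negf)
  have \<Phi>_dist: "norm (\<Phi> z - \<Phi> z') \<le> \<epsilon>" if "\<And>l. \<bar>z l - z' l\<bar> \<le> 1" for z z'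
  proof -
    have "norm (\<Phi> z - \<Phi> z') = norm (\<Sum>i<n. (e * of_int (z i - z' i)) *\<^sub>R b i)"
      by (simp add: \<Phi>_def sum_subtractf algebra_simps)
    also have "\<dots> \<le> (\<Sum>i<n. e * norm (b i))"
    proof (intro order_trans[OF norm_sum] sum_mono)
      fix i
      have "\<bar>real_of_int (z i - z' i)\<bar> \<le> 1" using that[of i] by linarith
      then show "norm ((e * of_int (z i - z' i)) *\<^sub>R b i) \<le> e * norm (b i)"
        using e(1) by (simp add: abs_mult mult_left_le_one_le mult_right_mono)
    qed
    also have "\<dots> \<le> \<epsilon>" using e(2) by (simp add: sum_distrib_left)
    finally show ?thesis .
  qed
  define D where "D = {z. (\<forall>l\<ge>n. z l = 0) \<and> \<Phi> z \<in> U}"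
  have "finite D"
  proof -
    obtain C where C: "C \<ge> 0"
        "\<forall>c. \<forall>i<n. \<bar>c i\<bar> \<le> C * norm (\<Sum>i<n. c i *\<^sub>R b i)"
      using coordinates_norm_bound[OF indep] by blast
    obtain r where r: "\<And>x. x \<in> U \<inter> span (b ` {..<n}) \<Longrightarrow> norm x \<le> r"
      using U(3) by (auto simp: bounded_iff)
    let ?m = "\<lceil>C * r / e\<rceil>"
    have "z i \<in> {-?m..?m}" if z: "z \<in> D" and i: "i < n" for z i
    proof -
      have "\<bar>e * of_int (z i)\<bar> \<le> C * norm (\<Phi> z)"
        using C(2)[rule_format, of i "\<lambda>i. e * of_int (z i)"] i by (simp add: \<Phi>_def)
      also have "\<dots> \<le> C * r" using r[of "\<Phi> z"] z \<Phi>_span C(1) by (intro mult_left_mono) (auto simp: D_def)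
      finally have "\<bar>of_int (z i)\<bar> \<le> C * r / e" using e(1) by (simp add: abs_mult field_simps)
      then have "of_int \<bar>z i\<bar> \<le> C * r / e" by simp
      then have "\<bar>z i\<bar> \<le> ?m" by linarith
      then show ?thesis by auto
    qed
    then have "D \<subseteq> {z. \<forall>i. (i \<in> {..<n} \<longrightarrow> z i \<in> {-?m..?m}) \<and> (i \<notin> {..<n} \<longrightarrow> z i = 0)}"
      by (auto simp: D_def)
    then show ?thesis by (rule finite_subset) (intro finite_set_of_finite_funs, auto)
  qed
  define J where "J x = (SOME j. j < k \<and> (\<forall>i<k. \<bar>h i x\<bar> \<le> \<bar>h j x\<bar>))" for x
  have J: "J x < k \<and> (\<forall>i<k. \<bar>h i x\<bar> \<le> \<bar>h (J x) x\<bar>)" if "0 < k" for x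
  proof -
    let ?m = "Max ((\<lambda>i. \<bar>h i x\<bar>) ` {..<k})"
    have "?m \<in> (\<lambda>i. \<bar>h i x\<bar>) ` {..<k}" using that by (intro Max_in) auto
    then obtain j where "j < k" "\<bar>h j x\<bar> = ?m" by auto
    then have "j < k \<and> (\<forall>i<k. \<bar>h i x\<bar> \<le> \<bar>h j x\<bar>)" by (auto intro: Max_ge)
    then show ?thesis unfolding J_def by (rule someI)
  qed
  have J_minus: "J (- x) = J x" for x
    unfolding J_def using odd by (intro arg_cong[of _ _ Eps] ext) auto
  define lab where "lab z = 2 * J (\<Phi> z) + of_bool (0 < h (J (\<Phi> z)) (\<Phi> z))" for z
  have lab_div: "lab z div 2 = J (\<Phi> z)" for z by (simp add: lab_def)
  have zero: "(\<lambda>_. 0) \<in> D" using U(1) by (simp add: D_def \<Phi>_def)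
  have sym: "(\<lambda>l. - z l) \<in> D" if "z \<in> D" for z using that U(2) by (auto simp: D_def \<Phi>_minus)
  obtain T u v where T: "near_boundary n D T" "u \<in> T" "v \<in> T"
    and l: "k \<le> lab u div 2 \<or> lab (\<lambda>l. - u l) \<noteq> flip (lab u) \<or> lab u = flip (lab v)"
    by (rule lattice_borsuk[OF \<open>finite D\<close> sym zero \<open>k < n\<close>])
  obtain w where w: "w \<notin> D" "\<forall>l\<ge>n. w l = 0" "adjacent (insert w T)" "T \<subseteq> D"
    using T(1) by (auto simp: near_boundary_def)
  show ?thesis
  proof (rule exI[of _ "\<Phi> u"], rule exI[of _ "\<Phi> v"], rule exI[of _ "\<Phi> w"], intro conjI allI impI)
    show "\<Phi> u \<in> span (b ` {..<n})" by (rule \<Phi>_span)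
    show "\<Phi> u \<in> U" using T w by (auto simp: D_def)
    show "\<Phi> w \<notin> U" using w by (auto simp: D_def)
    show "norm (\<Phi> v - \<Phi> u) \<le> \<epsilon>" "norm (\<Phi> w - \<Phi> u) \<le> \<epsilon>"
      using w(3) T by (auto intro!: \<Phi>_dist simp: adjacent_def)
    fix i assume i: "i < k"
    let ?j = "J (\<Phi> u)"
    have max: "?j < k" "\<bar>h i (\<Phi> u)\<bar> \<le> \<bar>h ?j (\<Phi> u)\<bar>" using J[of "\<Phi> u"] i by auto
    have "\<bar>h ?j (\<Phi> u)\<bar> \<le> \<bar>h ?j (\<Phi> u) - h ?j (\<Phi> v)\<bar>"
    proof -
      from l consider "lab (\<lambda>l. - u l) \<noteq> flip (lab u)" | "lab u = flip (lab v)"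
        using max(1) by (auto simp: lab_div)
      then show ?thesis
      proof cases
        case 1
        have "h ?j (\<Phi> u) = 0"
          using 1 odd[OF max(1), of "\<Phi> u"]
          by (cases "h ?j (\<Phi> u)" "0 :: real" rule: linorder_cases)
            (auto simp: lab_def \<Phi>_minus J_minus flip_def)
        then show ?thesis by simp
      next
        case 2
        then have "?j = J (\<Phi> v)" using lab_div flip_div_2 by metis
        moreover have "odd (lab u) \<longleftrightarrow> even (lab v)" using 2 by simp
        ultimately have "0 < h ?j (\<Phi> u) \<longleftrightarrow> \<not> 0 < h ?j (\<Phi> v)" by (simp add: lab_def)
        then show ?thesis by linarith
      qed
    qed
    also have "\<dots> \<le> (\<Sum>j<k. \<bar>h j (\<Phi> u) - h j (\<Phi> v)\<bar>)"
      using max(1) by (intro member_le_sum) auto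
    finally show "\<bar>h i (\<Phi> u)\<bar> \<le> (\<Sum>j<k. \<bar>h j (\<Phi> u) - h j (\<Phi> v)\<bar>)" using max(2) by linarith
  qed
qed

text \<open>
  Let the mesh of the grid tend to zero. Bounded parts of a finite-dimensional space are compact, so
  the points \<open>x\<close>, \<open>y\<close> and \<open>w\<close> of \<open>borsuk_grid\<close> have a common limit along a subsequence; it is a limit of
  points of \<open>U\<close> as well as of points outside \<open>U\<close>.
\<close>

theorem borsuk_common_zero:
  fixes b :: "nat \<Rightarrow> 'x::real_normed_vector" and h :: "nat \<Rightarrow> 'x \<Rightarrow> real"
  assumes indep: "\<And>c. (\<Sum>i<n. c i *\<^sub>R b i) = 0 \<Longrightarrow> \<forall>i<n. c i = 0"
    and U: "open U" "0 \<in> U" "\<And>x. x \<in> U \<Longrightarrow> - x \<in> U" "bounded (U \<inter> span (b ` {..<n}))"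
    and "k < n" and odd: "\<And>i x. i < k \<Longrightarrow> h i (- x) = - h i x"
    and cont: "\<And>i. i < k \<Longrightarrow> continuous_on UNIV (h i)"
  shows "\<exists>p. p \<in> span (b ` {..<n}) \<and> p \<in> closure U \<and> p \<notin> U \<and> (\<forall>i<k. h i p = 0)"
proof -
  define P where "P m x y w \<longleftrightarrow> x \<in> span (b ` {..<n}) \<and> x \<in> U \<and> w \<notin> U \<and>
      norm (y - x) \<le> 1 / real (Suc m) \<and> norm (w - x) \<le> 1 / real (Suc m) \<and>
      (\<forall>i<k. \<bar>h i x\<bar> \<le> (\<Sum>j<k. \<bar>h j x - h j y\<bar>))" for m x y w
  have "\<exists>x y w. P m x y w" for m
    unfolding P_def by (rule borsuk_grid) (use assms in auto)
  then obtain x y w where P: "\<And>m. P m (x m) (y m) (w m)" by metis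
  then have xyw: "\<And>m. x m \<in> span (b ` {..<n})" "\<And>m. x m \<in> U" "\<And>m. w m \<notin> U"
      "\<And>m. norm (y m - x m) \<le> 1 / real (Suc m)" "\<And>m. norm (w m - x m) \<le> 1 / real (Suc m)"
      "\<And>m i. i < k \<Longrightarrow> \<bar>h i (x m)\<bar> \<le> (\<Sum>j<k. \<bar>h j (x m) - h j (y m)\<bar>)"
    by (simp_all add: P_def)
  obtain r where r: "\<And>x. x \<in> U \<inter> span (b ` {..<n}) \<Longrightarrow> norm x \<le> r"
    using U(4) by (auto simp: bounded_iff)
  have "compact (span (b ` {..<n}) \<inter> cball 0 r)" by (rule compact_span_Int_cball) (rule indep)
  moreover have "\<forall>m. x m \<in> span (b ` {..<n}) \<inter> cball 0 r" using r xyw(1,2) by auto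
  ultimately obtain p s where p: "p \<in> span (b ` {..<n}) \<inter> cball 0 r" "strict_mono s" "(x \<circ> s) \<longlonglongrightarrow> p"
    unfolding compact_eq_seq_compact_metric seq_compact_def by metis
  have lim0: "(\<lambda>m. 1 / real (Suc (s m))) \<longlonglongrightarrow> 0"
    using LIMSEQ_subseq_LIMSEQ[OF LIMSEQ_Suc[OF lim_1_over_n] p(2)] by (simp add: comp_def)
  have xs: "(\<lambda>m. x (s m)) \<longlonglongrightarrow> p" using p(3) by (simp add: comp_def)
  have near: "(\<lambda>m. q (s m)) \<longlonglongrightarrow> p" if "\<And>m. norm (q m - x m) \<le> 1 / real (Suc m)" for q
  proof -
    have "(\<lambda>m. q (s m) - x (s m)) \<longlonglongrightarrow> 0" using that by (intro Lim_null_comparison[OF _ lim0]) auto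
    from tendsto_add[OF this xs] show ?thesis by simp
  qed
  note ys = near[OF xyw(4)] and ws = near[OF xyw(5)]
  have lim_h: "(\<lambda>m. h i (q m)) \<longlonglongrightarrow> h i p" if "i < k" "q \<longlonglongrightarrow> p" for i q
    using cont[OF that(1)] that(2) by (auto simp: continuous_on_eq_continuous_at continuous_at_sequentially comp_def)
  show ?thesis
  proof (intro exI[of _ p] conjI allI impI)
    show "p \<in> span (b ` {..<n})" using p(1) by blast
    show "p \<in> closure U" unfolding closure_sequential using xs xyw(2) by (intro exI[of _ "\<lambda>m. x (s m)"]) auto
    have "p \<in> - U" by (rule closed_sequentially[OF _ _ ws]) (use U(1) xyw(3) in auto)
    then show "p \<notin> U" by simp
    fix i assume i: "i < k"
    have "(\<lambda>m. \<Sum>j<k. \<bar>h j (x (s m)) - h j (y (s m))\<bar>) \<longlonglongrightarrow> (\<Sum>j<k. \<bar>h j p - h j p\<bar>)"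
      using lim_h xs ys by (intro tendsto_sum tendsto_rabs tendsto_diff) auto
    then have "(\<lambda>m. h i (x (s m))) \<longlonglongrightarrow> 0"
      using xyw(6)[OF i] by (intro Lim_null_comparison[of "\<lambda>m. h i (x (s m))" "\<lambda>m. \<Sum>j<k. \<bar>h j (x (s m)) - h j (y (s m))\<bar>"]) auto
    then show "h i p = 0" using lim_h[OF i xs] by (rule LIMSEQ_unique[OF _ _, rotated])
  qed
qed

section \<open>Images of finite-dimensional subspaces under odd homeomorphisms\<close>

text \<open>
  The set \<open>U = \<gamma> -` interior N\<close> is an open symmetric neighborhood of \<open>0\<close> with bounded trace on \<open>V\<close>, and the
  coordinates of \<open>\<gamma>\<close> modulo \<open>Z\<close> are fewer than \<open>dim V\<close> odd functions. A common zero of them on the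
  boundary of \<open>U\<close> is mapped into \<open>frontier N \<inter> Z\<close>.
\<close>

theorem image_meets_frontier_of_neighborhood:
  fixes \<iota> :: "'x::banach \<Rightarrow> 'w::banach"
  assumes embedding: "bounded_linear \<iota>" "inj \<iota>"
    and Z: "closed Z" "subspace Z" and V: "\<exists>B. finite B \<and> V = span B"
    and codim: "codim Z < enat (dim V)"
    and N: "0 \<in> interior N" "\<And>u. u \<in> N \<Longrightarrow> - u \<in> N" "bounded (\<iota> ` N)"
    and \<gamma>: "\<gamma> \<in> \<Gamma> V R"
  obtains u where "u \<in> V" "\<gamma> u \<in> frontier N" "\<gamma> u \<in> Z"
proof -
  obtain B where B: "finite B" "quotient_basis Z B" "card B < dim V"
    by (rule codim_less_enatE[OF Z(2) codim])
  obtain H :: "'x \<Rightarrow> 'x \<Rightarrow> real" where H: "\<And>b. b \<in> B \<Longrightarrow> continuous_on UNIV (H b)"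
      "\<And>b x. b \<in> B \<Longrightarrow> H b (- x) = - H b x" "\<And>x. \<forall>b\<in>B. H b x = 0 \<Longrightarrow> x \<in> Z"
    by (rule coordinates_modulo_closed_subspace[OF Z B(1,2)]) blast
  obtain g where g: "bij_betw g {..<card B} B"
    using ex_bij_betw_nat_finite[OF B(1)] by (auto simp: atLeast0LessThan)
  define n where "n = dim V"
  have "\<exists>e. V = span (e ` {..<n}) \<and> (\<forall>c. (\<Sum>i<n. c i *\<^sub>R e i) = 0 \<longrightarrow> (\<forall>i<n. c i = 0))"
    unfolding n_def by (rule finite_dim_indexed_basis[OF V])
  then obtain e where V_eq: "V = span (e ` {..<n})"
      and "\<forall>c. (\<Sum>i<n. c i *\<^sub>R e i) = 0 \<longrightarrow> (\<forall>i<n. c i = 0)"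
    by (elim exE conjE)
  then have indep: "\<And>c. (\<Sum>i<n. c i *\<^sub>R e i) = 0 \<Longrightarrow> \<forall>i<n. c i = 0" by blast
  obtain \<gamma>' where "homeomorphism UNIV UNIV \<gamma> \<gamma>'" and \<gamma>_odd: "\<And>u. \<gamma> (- u) = - \<gamma> u"
    and \<gamma>_id: "\<And>u. u \<in> V \<Longrightarrow> norm u \<ge> R \<Longrightarrow> \<gamma> u = u"
    using \<gamma> by (auto simp: \<Gamma>_def)
  then have \<gamma>_cont: "continuous_on UNIV \<gamma>" by (simp add: homeomorphism_def)
  have \<gamma>_0: "\<gamma> 0 = 0" using \<gamma>_odd[of 0] by (simp add: eq_neg_iff_add_eq_0 flip: scaleR_2)
  define U where "U = \<gamma> -` interior N"
  have U_sym: "- x \<in> U" if "x \<in> U" for x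
  proof -
    have "open (uminus -` interior N)"
      by (rule open_vimage[OF open_interior]) (intro continuous_intros)
    moreover have "uminus -` interior N \<subseteq> N"
      using N(2) interior_subset[of N] by (metis minus_minus subsetD subsetI vimageE)
    ultimately have "uminus -` interior N \<subseteq> interior N" by (rule interior_maximal[rotated])
    then show ?thesis using that by (auto simp: U_def \<gamma>_odd)
  qed
  \<comment> \<open>Where \<open>\<gamma>\<close> fixes a point of \<open>V \<inter> U\<close>, the point lies in \<open>N\<close>, so its image under \<open>\<iota>\<close> is bounded, and the coordinates of the image bound the point itself.\<close>
  have "bounded (U \<inter> span (e ` {..<n}))"
  proof -
    interpret \<iota>: bounded_linear \<iota> by fact
    have indep_W: "\<forall>i<n. c i = 0" if "(\<Sum>i<n. c i *\<^sub>R \<iota> (e i)) = 0" for c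
    proof -
      have "\<iota> (\<Sum>i<n. c i *\<^sub>R e i) = \<iota> 0" using that by (simp add: \<iota>.sum \<iota>.scaleR \<iota>.zero)
      then show ?thesis using indep[of c] injD[OF embedding(2)] by blast
    qed
    have "\<exists>C\<ge>0. \<forall>c. \<forall>i<n. \<bar>c i\<bar> \<le> C * norm (\<Sum>i<n. c i *\<^sub>R \<iota> (e i))"
      by (rule coordinates_norm_bound) (rule indep_W)
    then obtain C where C: "C \<ge> 0"
        "\<forall>c. \<forall>i<n. \<bar>c i\<bar> \<le> C * norm (\<Sum>i<n. c i *\<^sub>R \<iota> (e i))"
      by (elim exE conjE)
    obtain r where r: "\<And>x. x \<in> N \<Longrightarrow> norm (\<iota> x) \<le> r" using N(3) by (auto simp: bounded_iff)
    have "norm x \<le> max R (\<Sum>i<n. C * r * norm (e i))" if x: "x \<in> U" "x \<in> span (e ` {..<n})" for x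
    proof (cases "R \<le> norm x")
      case True
      then have "x \<in> N" using \<gamma>_id[of x] x interior_subset[of N] by (auto simp: U_def V_eq)
      obtain c where c: "x = (\<Sum>i<n. c i *\<^sub>R e i)"
        using x(2) span_image_coordinates[of "{..<n}" e] by auto
      then have "\<iota> x = (\<Sum>i<n. c i *\<^sub>R \<iota> (e i))" by (simp add: \<iota>.sum \<iota>.scaleR)
      then have "\<bar>c i\<bar> \<le> C * norm (\<iota> x)" if "i < n" for i
        using C(2)[rule_format, of i c] that by simp
      then have le: "\<bar>c i\<bar> \<le> C * r" if "i < n" for i
        using that r[OF \<open>x \<in> N\<close>] C(1) by (meson mult_left_mono order_trans)
      have "norm x \<le> (\<Sum>i<n. C * r * norm (e i))"
        unfolding c using le by (intro order_trans[OF norm_sum] sum_mono) (auto intro: mult_right_mono)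
      then show ?thesis by simp
    qed simp
    then show ?thesis by (auto simp: bounded_iff)
  qed
  then have "\<exists>p. p \<in> span (e ` {..<n}) \<and> p \<in> closure U \<and> p \<notin> U \<and>
      (\<forall>i<card B. H (g i) (\<gamma> p) = 0)"
  proof (rule borsuk_common_zero[rotated 4])
    show "open U" unfolding U_def by (rule open_vimage[OF open_interior \<gamma>_cont])
    show "0 \<in> U" using N(1) by (simp add: U_def \<gamma>_0)
    show "card B < n" using B(3) by (simp add: n_def)
    show "continuous_on UNIV (\<lambda>x. H (g i) (\<gamma> x))" if "i < card B" for i
      using H(1)[of "g i"] that g continuous_on_compose2[OF _ \<gamma>_cont, of UNIV "H (g i)"]
      by (auto simp: bij_betw_def)
    show "H (g i) (\<gamma> (- x)) = - H (g i) (\<gamma> x)" if "i < card B" for i x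
      using H(2)[of "g i"] that g by (auto simp: bij_betw_def \<gamma>_odd)
  qed (fact indep U_sym)+
  then obtain p where p: "p \<in> span (e ` {..<n})" "p \<in> closure U" "p \<notin> U"
      "\<forall>i<card B. H (g i) (\<gamma> p) = 0"
    by (elim exE conjE)
  have "\<gamma> p \<in> closure N"
  proof -
    have "\<gamma> ` closure U \<subseteq> closure (\<gamma> ` U)"
      by (rule continuous_image_closure_subset[OF continuous_on_subset[OF \<gamma>_cont]]) auto
    also have "\<dots> \<subseteq> closure N" using interior_subset[of N] by (intro closure_mono) (auto simp: U_def)
    finally show ?thesis using p(2) by blast
  qed
  then have "\<gamma> p \<in> frontier N" using p(3) by (simp add: frontier_def U_def)
  moreover have "\<gamma> p \<in> Z"
  proof (rule H(3), rule ballI)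
    fix b assume "b \<in> B"
    then obtain i where "i < card B" "b = g i" using g by (auto simp: bij_betw_def)
    then show "H b (\<gamma> p) = 0" using p(4) by simp
  qed
  ultimately show thesis using that p(1) V_eq by blast
qed

section \<open>Ekeland sequences and odd descent homeomorphisms\<close>

text \<open>
  Banach's fixed point theorem for \<open>\<lambda>y. z - t *\<^sub>R v y\<close> solves \<open>y + t *\<^sub>R v y = z\<close>, and the map expands distances at least
  by the factor \<open>1 - t * L\<close>, so the inverse is Lipschitz continuous.
\<close>

lemma homeomorphism_id_plus_lipschitz:
  fixes v :: "'x::banach \<Rightarrow> 'x"
  assumes v: "L-lipschitz_on UNIV v" and t: "0 \<le> t" "t * L < 1"
  shows "\<exists>g. homeomorphism UNIV UNIV (\<lambda>y. y + t *\<^sub>R v y) g"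
proof -
  define f where "f y = y + t *\<^sub>R v y" for y
  have lower: "(1 - t * L) * dist x y \<le> dist (f x) (f y)" for x y
  proof -
    have "norm (t *\<^sub>R v x - t *\<^sub>R v y) \<le> t * (L * dist x y)"
      using lipschitz_onD[OF v, of x y] t(1)
      by (simp add: dist_norm mult_left_mono flip: scaleR_diff_right)
    moreover have "x - y = (f x - f y) - (t *\<^sub>R v x - t *\<^sub>R v y)" by (simp add: f_def)
    then have "norm (x - y) \<le> norm (f x - f y) + norm (t *\<^sub>R v x - t *\<^sub>R v y)"
      by (metis norm_triangle_ineq4)
    ultimately show ?thesis by (simp add: dist_norm algebra_simps)
  qed
  have "inj f"
  proof (rule injI)
    fix x y assume "f x = f y"
    then have "(1 - t * L) * dist x y \<le> 0" using lower[of x y] by simp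
    then show "x = y" using t(2) by (simp add: mult_le_0_iff)
  qed
  moreover have "surj f"
  proof (unfold surj_def, rule allI)
    fix z
    have "\<exists>!y. z - t *\<^sub>R v y = y"
    proof (rule banach_fix_type[where c = "t * L"])
      show "0 \<le> t * L" using t(1) lipschitz_on_nonneg[OF v] by simp
      show "\<forall>x y. dist (z - t *\<^sub>R v x) (z - t *\<^sub>R v y) \<le> t * L * dist x y"
        using lipschitz_onD[OF v] t(1)
        by (auto simp: dist_norm mult.assoc norm_minus_commute intro!: mult_left_mono simp flip: scaleR_diff_right)
    qed fact
    then show "\<exists>y. z = f y" by (metis f_def diff_add_cancel)
  qed
  ultimately have inv: "f (inv f y) = y" "inv f (f y) = y" for y
    by (simp_all add: surj_f_inv_f)
  have "continuous_on UNIV f"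
    unfolding f_def by (intro continuous_intros lipschitz_on_continuous_on[OF v])
  moreover have "(1 / (1 - t * L))-lipschitz_on UNIV (inv f)"
  proof (rule lipschitz_onI)
    show "dist (inv f x) (inv f y) \<le> 1 / (1 - t * L) * dist x y" for x y
      using lower[of "inv f x" "inv f y"] t(2) by (simp add: inv field_simps)
  qed (use t(2) in simp)
  then have "continuous_on UNIV (inv f)" by (rule lipschitz_on_continuous_on)
  ultimately have "homeomorphism UNIV UNIV f (inv f)"
    using inv \<open>surj f\<close> by (auto simp: homeomorphism_def image_iff) (metis inv(2))
  then show ?thesis by (auto simp: f_def[abs_def])
qed

text \<open>
  The iteration behind Ekeland's variational principle: \<open>g (Suc m)\<close> almost minimizes \<open>\<Psi>\<close> among the points
  that can be reached from \<open>g m\<close> at a cost, \<open>c\<close> times the distance, covered by the decrease of \<open>\<Psi>\<close>. It is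
  stated for sequences, without a limit point, since \<open>S\<close> need not be complete.
\<close>

lemma ekeland_sequence:
  fixes \<Psi> :: "'a \<Rightarrow> real" and d :: "'a \<Rightarrow> 'a \<Rightarrow> real"
  assumes "g0 \<in> S" and bound: "\<And>g. g \<in> S \<Longrightarrow> \<beta> \<le> \<Psi> g" and d: "\<And>g. g \<in> S \<Longrightarrow> d g g = 0"
  shows "\<exists>g. g 0 = g0 \<and> (\<forall>m. g m \<in> S) \<and>
    (\<forall>m. \<Psi> (g (Suc m)) + c * d (g m) (g (Suc m)) \<le> \<Psi> (g m)) \<and>
    (\<forall>m. \<forall>h\<in>S. \<Psi> h + c * d (g m) h \<le> \<Psi> (g m) \<longrightarrow> \<Psi> (g (Suc m)) - (1/2) ^ m \<le> \<Psi> h)"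
proof -
  define next_ok where "next_ok m g g' \<longleftrightarrow> \<Psi> g' + c * d g g' \<le> \<Psi> g \<and>
     (\<forall>h\<in>S. \<Psi> h + c * d g h \<le> \<Psi> g \<longrightarrow> \<Psi> g' - (1/2) ^ m \<le> \<Psi> h)" for m g g'
  define step where "step m g = (SOME g'. g' \<in> S \<and> next_ok m g g')" for m g
  have ex: "\<exists>g'. g' \<in> S \<and> next_ok m g g'" if g: "g \<in> S" for m :: nat and g
  proof -
    define A where "A = {h \<in> S. \<Psi> h + c * d g h \<le> \<Psi> g}"
    have "g \<in> A" using g d by (simp add: A_def)
    have bdd: "bdd_below (\<Psi> ` A)" by (rule bdd_belowI2[of _ \<beta>]) (auto simp: A_def bound)
    have "Inf (\<Psi> ` A) < Inf (\<Psi> ` A) + (1/2) ^ m" by simp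
    then obtain g' where g': "g' \<in> A" "\<Psi> g' < Inf (\<Psi> ` A) + (1/2) ^ m"
      using cInf_lessD[of "\<Psi> ` A"] \<open>g \<in> A\<close> by blast
    have "\<Psi> g' - (1/2) ^ m \<le> \<Psi> h" if "h \<in> A" for h
      using cInf_lower[OF imageI[OF that] bdd] g'(2) by linarith
    then show ?thesis using g'(1) by (intro exI[of _ g']) (auto simp: A_def next_ok_def)
  qed
  have step: "step m g \<in> S \<and> next_ok m g (step m g)" if "g \<in> S" for m g
    unfolding step_def by (rule someI_ex) (rule ex[OF that])
  define g where "g = rec_nat g0 step"
  have "g 0 = g0" "\<And>m. g (Suc m) = step m (g m)" by (simp_all add: g_def)
  moreover have "g m \<in> S" for m
    by (induction m) (use \<open>g0 \<in> S\<close> step in \<open>auto simp: g_def\<close>)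
  ultimately have "g 0 = g0 \<and> (\<forall>m. g m \<in> S) \<and> (\<forall>m. next_ok m (g m) (g (Suc m)))"
    using step by simp
  then show ?thesis unfolding next_ok_def by (intro exI[of _ g]) blast
qed

lemma derivative_even:
  fixes J :: "'x::real_normed_vector \<Rightarrow> real"
  assumes J: "\<And>u. (J has_derivative blinfun_apply (dJ u)) (at u)" and even: "\<And>u. J (- u) = J u"
  shows "dJ (- u) = - dJ u"
proof (rule blinfun_eqI)
  fix h
  have "((\<lambda>u. J (- u)) has_derivative (\<lambda>h. dJ (- u) (- h))) (at u)"
    by (rule has_derivative_compose[OF _ J]) (auto intro!: derivative_eq_intros)
  then have "(J has_derivative (\<lambda>h. dJ (- u) (- h))) (at u)" by (simp add: even)
  from has_derivative_unique[OF this J] have "dJ (- u) (- h) = dJ u h" by metis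
  then show "blinfun_apply (dJ (- u)) h = blinfun_apply (- dJ u) h"
    by (simp add: blinfun.minus_right blinfun.minus_left)
qed

lemma blinfun_descent_direction:
  fixes f :: "'x::real_normed_vector \<Rightarrow>\<^sub>L real"
  assumes "\<mu> < norm f" "0 \<le> \<mu>"
  obtains w where "norm w = 1" "f w < - \<mu>"
proof -
  have "\<exists>w. \<mu> * norm w < norm (f w)"
    using norm_blinfun_bound[OF assms(2), of f] assms(1) by (meson not_le)
  then obtain w where w: "\<mu> * norm w < \<bar>f w\<bar>" by auto
  then have "w \<noteq> 0" by (auto simp: blinfun.zero_right)
  define w' where "w' = (- sgn (f w) / norm w) *\<^sub>R w"
  have "f w \<noteq> 0" using w \<open>w \<noteq> 0\<close> assms(2) by (auto simp: mult_less_0_iff not_less)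
  then have "norm w' = 1" using \<open>w \<noteq> 0\<close> by (simp add: w'_def abs_sgn_eq)
  moreover have "f w' = - (\<bar>f w\<bar> / norm w)" unfolding w'_def blinfun.scaleR_right by (simp add: abs_sgn mult.commute)
  moreover have "\<mu> < \<bar>f w\<bar> / norm w" using w \<open>w \<noteq> 0\<close> by (simp add: pos_less_divide_eq)
  ultimately have "norm w' = 1" "f w' < - \<mu>" by simp_all
  then show thesis by (rule that)
qed

lemma compact_positive_lower_bound:
  fixes f :: "'a::topological_space \<Rightarrow> real"
  assumes "compact K" "continuous_on K f" "\<And>x. x \<in> K \<Longrightarrow> 0 < f x"
  obtains c where "c > 0" "\<And>x. x \<in> K \<Longrightarrow> c \<le> f x"
proof (cases "K = {}")
  case True
  then show thesis using that[of 1] by simp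
next
  case False
  then obtain x where "x \<in> K" "\<forall>y\<in>K. f x \<le> f y" using continuous_attains_inf[OF assms(1) _ assms(2)] by blast
  then show thesis using that[of "f x"] assms(3) by auto
qed

text \<open>
  Each point \<open>x\<close> of \<open>K\<close> at a level near \<open>s\<close> has a unit vector \<open>w x\<close> along which \<open>J\<close> decreases at a rate above \<open>\<mu>\<close>, even in a
  ball around \<open>x\<close>. Since \<open>J\<close> is even, \<open>- w x\<close> does the same around \<open>- x\<close>. Finitely many such balls cover the
  relevant part of \<open>K\<close>, and Lipschitz bump functions \<open>\<phi> x\<close> combine the directions into an odd Lipschitz vector field
  \<open>v\<close> of norm at most \<open>1\<close>. A single Euler step \<open>y + t *\<^sub>R v y\<close> with small \<open>t\<close> is then a homeomorphism with
  all the required properties. It fixes the points with \<open>J y \<le> 0\<close> because \<open>J\<close> is positive on the balls.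
\<close>

lemma odd_descent_homeomorphism:
  fixes J :: "'x::banach \<Rightarrow> real"
  assumes J: "\<And>u. (J has_derivative blinfun_apply (dJ u)) (at u)" and dJ: "continuous_on UNIV dJ"
    and even: "\<And>u. J (- u) = J u" and K: "compact K" "\<And>x. x \<in> K \<Longrightarrow> J x \<le> s"
    and \<delta>: "0 < \<delta>" "\<delta> < s" and \<mu>: "0 < \<mu>" "\<And>x. x \<in> K \<Longrightarrow> s - \<delta> \<le> J x \<Longrightarrow> \<mu> < norm (dJ x)"
  shows "\<exists>\<eta> \<eta>' t. 0 < t \<and> homeomorphism UNIV UNIV \<eta> \<eta>' \<and> (\<forall>y. \<eta> (- y) = - \<eta> y) \<and>
     (\<forall>y. J y \<le> 0 \<longrightarrow> \<eta> y = y) \<and> (\<forall>y. norm (\<eta> y - y) \<le> t) \<and> (\<forall>y\<in>K. J (\<eta> y) \<le> s - \<mu> * t)"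
proof -
  have J_cont: "continuous_on A J" for A
    using J by (meson has_derivative_continuous_on has_derivative_at_withinI)
  define K' where "K' = {x \<in> K. s - \<delta> \<le> J x}"
  have "K' = K \<inter> J -` {s - \<delta>..}" by (auto simp: K'_def)
  moreover have "closed (J -` {s - \<delta>..})" by (rule closed_vimage[OF _ J_cont]) simp
  ultimately have "compact K'" using K(1) by (simp add: compact_Int_closed)
  have "\<exists>w r. norm w = 1 \<and> 0 < r \<and> (\<forall>y\<in>ball x (2 * r). dJ y w < - \<mu> \<and> 0 < J y)" if x: "x \<in> K'" for x
  proof -
    obtain w where w: "norm w = 1" "dJ x w < - \<mu>"
      using blinfun_descent_direction[of \<mu> "dJ x"] \<mu> x by (auto simp: K'_def)
    have "continuous_on UNIV (\<lambda>y. blinfun_apply (dJ y) w)" by (intro continuous_intros dJ)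
    then have "open ((\<lambda>y. blinfun_apply (dJ y) w) -` {..< - \<mu>} \<inter> J -` {0<..})"
      by (intro open_Int open_vimage J_cont) auto
    moreover have "x \<in> (\<lambda>y. blinfun_apply (dJ y) w) -` {..< - \<mu>} \<inter> J -` {0<..}"
      using w x \<delta> by (auto simp: K'_def)
    ultimately obtain r where "r > 0" "ball x r \<subseteq> (\<lambda>y. blinfun_apply (dJ y) w) -` {..< - \<mu>} \<inter> J -` {0<..}"
      using open_contains_ball by blast
    then show ?thesis using w by (intro exI[of _ w] exI[of _ "r / 2"]) auto
  qed
  then obtain w r where wr: "\<And>x. x \<in> K' \<Longrightarrow> norm (w x) = 1" "\<And>x. x \<in> K' \<Longrightarrow> 0 < r x"
      "\<And>x y. x \<in> K' \<Longrightarrow> y \<in> ball x (2 * r x) \<Longrightarrow> dJ y (w x) < - \<mu>"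
      "\<And>x y. x \<in> K' \<Longrightarrow> y \<in> ball x (2 * r x) \<Longrightarrow> 0 < J y"
    by metis
  obtain F where F: "F \<subseteq> K'" "finite F" "K' \<subseteq> (\<Union>x\<in>F. ball x (r x))"
    by (rule compactE_image[OF \<open>compact K'\<close>, of K' "\<lambda>x. ball x (r x)"]) (use wr(2) in \<open>auto intro!: UN_I\<close>)
  define \<phi> where "\<phi> x y = max 0 (r x - dist x y)" for x y
  have \<phi>_nonneg: "0 \<le> \<phi> x y" for x y by (simp add: \<phi>_def)
  have \<phi>_lip: "\<bar>\<phi> x y - \<phi> x z\<bar> \<le> dist y z" for x y z
    using dist_triangle[of x y z] dist_triangle[of x z y] by (auto simp: \<phi>_def dist_commute)
  define \<psi> where "\<psi> y = (\<Sum>x\<in>F. \<phi> x y + \<phi> x (- y))" for y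
  define P where "P y = (\<Sum>x\<in>F. (\<phi> x y - \<phi> x (- y)) *\<^sub>R w x)" for y
  define M where "M = (\<Sum>x\<in>F. 2 :: real)"
  have dist_neg: "dist (- y) (- z) = dist y z" for y z :: 'x by (simp add: dist_norm norm_minus_commute)
  have \<psi>_lip: "\<bar>\<psi> y - \<psi> z\<bar> \<le> M * dist y z" for y z
  proof -
    have "\<psi> y - \<psi> z = (\<Sum>x\<in>F. (\<phi> x y - \<phi> x z) + (\<phi> x (- y) - \<phi> x (- z)))"
      by (simp add: \<psi>_def sum_subtractf[symmetric] algebra_simps)
    also have "\<bar>\<dots>\<bar> \<le> (\<Sum>x\<in>F. 2 * dist y z)"
      using \<phi>_lip[of _ y z] \<phi>_lip[of _ "- y" "- z"] 
      by (intro order_trans[OF sum_abs] sum_mono) (smt (verit) dist_neg)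
    finally show ?thesis by (simp add: M_def sum_distrib_right)
  qed
  have P_lip: "norm (P y - P z) \<le> M * dist y z" for y z
  proof -
    have "P y - P z = (\<Sum>x\<in>F. ((\<phi> x y - \<phi> x z) - (\<phi> x (- y) - \<phi> x (- z))) *\<^sub>R w x)"
      by (simp add: P_def sum_subtractf[symmetric] algebra_simps)
    also have "norm \<dots> \<le> (\<Sum>x\<in>F. 2 * dist y z)"
      using \<phi>_lip[of _ y z] \<phi>_lip[of _ "- y" "- z"] wr(1) F(1)
      by (intro order_trans[OF norm_sum] sum_mono) (simp, smt (verit) dist_neg mult_cancel_left2 subsetD)
    finally show ?thesis by (simp add: M_def sum_distrib_right)
  qed
  have P_le: "norm (P y) \<le> \<psi> y" for y
    unfolding P_def \<psi>_def
    using wr(1) F(1) \<phi>_nonneg by (intro order_trans[OF norm_sum] sum_mono) (simp add: subset_iff abs_le_iff)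
  have \<psi>_nonneg: "0 \<le> \<psi> y" for y unfolding \<psi>_def by (intro sum_nonneg add_nonneg_nonneg \<phi>_nonneg)
  have \<psi>_pos: "0 < \<psi> y" if y: "y \<in> K'" for y
  proof -
    obtain x where x: "x \<in> F" "dist x y < r x" using F(3) y by auto
    have "0 < \<phi> x y + \<phi> x (- y)" using x \<phi>_nonneg[of x "- y"] by (simp add: \<phi>_def)
    also have "\<dots> \<le> \<psi> y" unfolding \<psi>_def
      using x(1) F(2) \<phi>_nonneg by (intro member_le_sum[of x F "\<lambda>x. \<phi> x y + \<phi> x (- y)"]) (auto intro: add_nonneg_nonneg)
    finally show ?thesis .
  qed
  have M: "M \<ge> 0" by (simp add: M_def sum_nonneg)
  have "M-lipschitz_on UNIV \<psi>" using \<psi>_lip M by (auto intro!: lipschitz_onI simp: dist_real_def)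
  then have "continuous_on K' \<psi>" using lipschitz_on_continuous_on continuous_on_subset by blast
  from compact_positive_lower_bound[OF \<open>compact K'\<close> this \<psi>_pos]
  obtain c where c: "c > 0" "\<And>y. y \<in> K' \<Longrightarrow> c \<le> \<psi> y" by blast
  \<comment> \<open>Dividing by \<open>max c (\<psi> y)\<close> instead of \<open>\<psi> y\<close> keeps the field Lipschitz continuous away from \<open>K'\<close>.\<close>
  define q where "q y = max c (\<psi> y)" for y
  have q: "q y > 0" "\<psi> y \<le> q y" "c \<le> q y" for y using c(1) by (auto simp: q_def)
  define v where "v y = (1 / q y) *\<^sub>R P y" for y
  have v_le: "norm (v y) \<le> 1" for y
    using P_le[of y] q[of y] by (simp add: v_def divide_le_eq_1)
  have v_lip: "(2 * M / c)-lipschitz_on UNIV v"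
  proof (rule lipschitz_onI)
    fix y z
    have "v y - v z = (1 / q y) *\<^sub>R (P y - P z) + ((q z - q y) / q y) *\<^sub>R v z"
    proof -
      have e: "1 / q y = 1 / q z + (q z - q y) / q y * (1 / q z)"
        using q(1)[of y] q(1)[of z] by (simp add: field_simps)
      have "(1 / q y) *\<^sub>R P z = (1 / q z) *\<^sub>R P z + ((q z - q y) / q y * (1 / q z)) *\<^sub>R P z"
        by (subst e) (rule scaleR_add_left)
      then show ?thesis by (simp add: v_def scaleR_diff_right)
    qed
    also have "norm \<dots> \<le> norm (P y - P z) / q y + \<bar>q z - q y\<bar> / q y"
    proof (rule norm_triangle_le, rule add_mono)
      have "\<bar>q z - q y\<bar> / q y * norm (v z) \<le> \<bar>q z - q y\<bar> / q y * 1"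
        using v_le[of z] q(1)[of y] by (intro mult_left_mono) auto
      then show "norm (((q z - q y) / q y) *\<^sub>R v z) \<le> \<bar>q z - q y\<bar> / q y"
        using q(1)[of y] by simp
    qed (use q(1)[of y] in simp)
    also have "\<dots> \<le> M * dist y z / c + M * dist y z / c"
    proof (intro add_mono frac_le)
      have "\<bar>q z - q y\<bar> \<le> \<bar>\<psi> y - \<psi> z\<bar>" by (auto simp: q_def)
      then show "\<bar>q z - q y\<bar> \<le> M * dist y z" using \<psi>_lip[of y z] by linarith
    qed (use P_lip q c(1) M in auto)
    finally show "dist (v y) (v z) \<le> 2 * M / c * dist y z" by (simp add: dist_norm)
  qed (use M c(1) in simp)
  have v_odd: "v (- y) = - v y" for y
  proof -
    have "\<psi> (- y) = \<psi> y" by (simp add: \<psi>_def add.commute)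
    moreover have "P (- y) = - P y" by (simp add: P_def sum_negf[symmetric] scaleR_minus_left[symmetric])
    ultimately show ?thesis by (simp add: v_def q_def)
  qed
  have v_zero: "v y = 0" if y: "J y \<le> 0" for y
  proof -
    have "\<phi> x z = 0" if "x \<in> F" "J z \<le> 0" for x z
      using wr(2)[of x] wr(4)[of x z] that F(1) by (force simp: \<phi>_def)
    then show ?thesis using y even by (simp add: v_def P_def)
  qed
  \<comment> \<open>The bounds on \<open>t\<close> make the step a homeomorphism, keep the other points of \<open>K\<close> below the target level, and keep the step inside the balls of double radius.\<close>
  obtain t where t: "0 < t" "t * (2 * M / c) < 1" "t * \<mu> \<le> \<delta>" "\<And>x. x \<in> F \<Longrightarrow> t \<le> r x"
  proof -
    define t where "t = Min (insert (c / (2 * M + c)) (insert (\<delta> / \<mu>) (r ` F)))"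
    have t: "0 < t" unfolding t_def using F wr(2) c(1) M \<delta> \<mu>(1) by (subst Min_gr_iff) auto
    have "t \<le> c / (2 * M + c)" "t \<le> \<delta> / \<mu>" "\<And>x. x \<in> F \<Longrightarrow> t \<le> r x"
      unfolding t_def by (rule Min_le; use F(2) in simp)+
    moreover have "t * (2 * M / c) < 1"
    proof -
      have "t * (2 * M + c) \<le> c" using \<open>t \<le> c / (2 * M + c)\<close> c(1) M by (simp add: pos_le_divide_eq)
      moreover have "0 < t * c" using t c(1) by simp
      ultimately show ?thesis using c(1) by (simp add: field_simps)
    qed
    ultimately show thesis using that[of t] t \<mu>(1) by (simp add: pos_le_divide_eq)
  qed
  define \<eta> where "\<eta> y = y + t *\<^sub>R v y" for y
  obtain \<eta>' where hom: "homeomorphism UNIV UNIV \<eta> \<eta>'"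
    using homeomorphism_id_plus_lipschitz[OF v_lip _ t(2)] t(1) unfolding \<eta>_def[abs_def] by auto
  have slope: "dJ (y + \<tau> *\<^sub>R v y) (v y) \<le> - \<mu> * (\<psi> y / q y)" if \<tau>: "0 \<le> \<tau>" "\<tau> \<le> t" for y \<tau>
  proof -
    let ?y = "y + \<tau> *\<^sub>R v y"
    have close: "norm (\<tau> *\<^sub>R v y) \<le> t" using \<tau> v_le[of y] by (simp add: mult_le_one mult_left_le order_trans[of _ \<tau>])
    have pos: "\<phi> x y * dJ ?y (w x) \<le> - \<mu> * \<phi> x y" if x: "x \<in> F" for x
    proof (cases "dist x y < r x")
      case True
      have "dist x ?y \<le> dist x y + norm (\<tau> *\<^sub>R v y)" using dist_triangle[of x ?y y] by (simp add: dist_norm)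
      then have "?y \<in> ball x (2 * r x)" using True close t(4)[OF x] by simp
      then have "dJ ?y (w x) \<le> - \<mu>" using wr(3)[of x ?y] x F(1) by force
      then show ?thesis using mult_left_mono[OF _ \<phi>_nonneg[of x y]] by (metis mult.commute)
    qed (simp add: \<phi>_def)
    have neg: "- (\<phi> x (- y) * dJ ?y (w x)) \<le> - \<mu> * \<phi> x (- y)" if x: "x \<in> F" for x
    proof (cases "dist x (- y) < r x")
      case True
      have "dist (- y) (- ?y) = norm (\<tau> *\<^sub>R v y)" by (simp add: dist_norm)
      then have "dist x (- ?y) \<le> dist x (- y) + norm (\<tau> *\<^sub>R v y)" using dist_triangle[of x "- ?y" "- y"] by simp
      then have "- ?y \<in> ball x (2 * r x)" using True close t(4)[OF x] by simp
      then have "dJ (- ?y) (w x) \<le> - \<mu>" using wr(3)[of x "- ?y"] x F(1) by force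
      then have "- dJ ?y (w x) \<le> - \<mu>"
        unfolding derivative_even[OF J even] by (simp add: blinfun.minus_left)
      then show ?thesis using mult_left_mono[OF _ \<phi>_nonneg[of x "- y"], of "- dJ ?y (w x)" "- \<mu>"] by (simp add: mult.commute)
    qed (simp add: \<phi>_def)
    have "dJ ?y (P y) = (\<Sum>x\<in>F. \<phi> x y * dJ ?y (w x) + - (\<phi> x (- y) * dJ ?y (w x)))"
      by (simp add: P_def blinfun.sum_right blinfun.scaleR_right left_diff_distrib)
    also have "\<dots> \<le> (\<Sum>x\<in>F. - \<mu> * \<phi> x y + - \<mu> * \<phi> x (- y))"
      by (intro sum_mono add_mono pos neg)
    also have "\<dots> = - \<mu> * \<psi> y" by (simp add: \<psi>_def sum_distrib_left algebra_simps sum_negf)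
    finally have "dJ ?y (P y) / q y \<le> - \<mu> * \<psi> y / q y" using q(1)[of y] by (intro divide_right_mono) auto
    moreover have "dJ ?y (v y) = dJ ?y (P y) / q y" by (simp add: v_def blinfun.scaleR_right)
    ultimately show ?thesis by simp
  qed
  have descent: "J (\<eta> y) \<le> J y - \<mu> * t * (\<psi> y / q y)" for y
  proof -
    have deriv: "((\<lambda>\<tau>. J (y + \<tau> *\<^sub>R v y)) has_real_derivative dJ (y + \<tau> *\<^sub>R v y) (v y)) (at \<tau>)" for \<tau>
    proof -
      have "((\<lambda>\<tau>. J (y + \<tau> *\<^sub>R v y)) has_derivative (\<lambda>h. dJ (y + \<tau> *\<^sub>R v y) (h *\<^sub>R v y))) (at \<tau>)"
        by (rule has_derivative_compose[OF _ J]) (auto intro!: derivative_eq_intros)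
      then show ?thesis by (simp add: has_field_derivative_def blinfun.scaleR_right mult.commute[of _ "dJ _ _"] cong: if_cong)
    qed
    obtain \<xi> where \<xi>: "0 < \<xi>" "\<xi> < t" "J (y + t *\<^sub>R v y) - J (y + 0 *\<^sub>R v y) = (t - 0) * dJ (y + \<xi> *\<^sub>R v y) (v y)"
      using MVT2[OF t(1), of "\<lambda>\<tau>. J (y + \<tau> *\<^sub>R v y)" "\<lambda>\<tau>. dJ (y + \<tau> *\<^sub>R v y) (v y)"] deriv by blast
    have "t * dJ (y + \<xi> *\<^sub>R v y) (v y) \<le> t * (- \<mu> * (\<psi> y / q y))"
      using \<xi> t(1) by (intro mult_left_mono slope) auto
    then show ?thesis using \<xi>(3) by (simp add: \<eta>_def algebra_simps)
  qed
  have "J (\<eta> y) \<le> s - \<mu> * t" if y: "y \<in> K" for y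
  proof (cases "y \<in> K'")
    case True
    then have "\<psi> y / q y = 1" using c by (simp add: q_def max_absorb2) (metis less_le_trans less_irrefl)
    then show ?thesis using descent[of y] K(2)[OF y] by simp
  next
    case False
    have "0 \<le> \<mu> * t * (\<psi> y / q y)" using \<mu>(1) t(1) \<psi>_nonneg[of y] q(1)[of y] by simp
    then have "J (\<eta> y) \<le> J y" using descent[of y] by linarith
    then show ?thesis using False y t(3) by (simp add: K'_def mult.commute)
  qed
  moreover have "\<eta> (- y) = - \<eta> y" for y by (simp add: \<eta>_def v_odd)
  moreover have "\<eta> y = y" if "J y \<le> 0" for y using v_zero[OF that] by (simp add: \<eta>_def)
  moreover have "norm (\<eta> y - y) \<le> t" for y
    using v_le[of y] t(1) by (simp add: \<eta>_def mult_left_le)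
  ultimately show ?thesis using hom t(1)
    by (intro exI[of _ \<eta>] exI[of _ \<eta>'] exI[of _ t]) blast
qed

section \<open>Deformation at the minimax level\<close>

lemma compact_image_uniformly_close:
  fixes F :: "'a::metric_space \<Rightarrow> real"
  assumes "compact K" "continuous_on UNIV F" "0 < e"
  obtains d where "d > 0" "\<And>x y. x \<in> K \<Longrightarrow> dist x y < d \<Longrightarrow> \<bar>F x - F y\<bar> < e"
proof -
  have "\<exists>r>0. \<forall>y\<in>ball x (2 * r). \<bar>F x - F y\<bar> < e / 2" for x
  proof -
    obtain r where "r > 0" "\<And>y. dist y x < r \<Longrightarrow> dist (F y) (F x) < e / 2"
      using assms(2,3) by (metis UNIV_I continuous_on_iff half_gt_zero)
    then show ?thesis by (intro exI[of _ "r / 2"]) (auto simp: dist_commute dist_real_def abs_minus_commute)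
  qed
  then obtain r where r: "\<And>x. r x > 0" "\<And>x y. y \<in> ball x (2 * r x) \<Longrightarrow> \<bar>F x - F y\<bar> < e / 2" by metis
  obtain A where A: "A \<subseteq> K" "finite A" "K \<subseteq> (\<Union>x\<in>A. ball x (r x))"
    by (rule compactE_image[OF assms(1), of K "\<lambda>x. ball x (r x)"]) (use r(1) in \<open>auto intro!: UN_I\<close>)
  define d where "d = Min (insert 1 (r ` A))"
  show thesis
  proof
    show "d > 0" using A(2) r(1) by (simp add: d_def)
    fix x y assume x: "x \<in> K" and xy: "dist x y < d"
    obtain a where a: "a \<in> A" "dist a x < r a" using A(3) x by auto
    have "d \<le> r a" unfolding d_def by (rule Min_le) (use A(2) a(1) in auto)
    then have "y \<in> ball a (2 * r a)" using a xy dist_triangle[of a y x] by simp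
    moreover have "x \<in> ball a (2 * r a)" using a r(1)[of a] by simp
    ultimately show "\<bar>F x - F y\<bar> < e" using r(2)[of x a] r(2)[of y a] by linarith
  qed
qed

lemma homeomorphism_comp_in_\<Gamma>:
  assumes "\<gamma> \<in> \<Gamma> V R" "homeomorphism UNIV UNIV \<eta> \<eta>'" "\<And>y. \<eta> (- y) = - \<eta> y"
    and "\<And>u. u \<in> V \<Longrightarrow> R \<le> norm u \<Longrightarrow> \<eta> u = u"
  shows "\<eta> \<circ> \<gamma> \<in> \<Gamma> V R"
  using assms homeomorphism_compose[of UNIV UNIV \<gamma> _ UNIV \<eta> \<eta>'] unfolding \<Gamma>_def by fastforce

lemma id_in_\<Gamma>: "(\<lambda>u. u) \<in> \<Gamma> V R"
  by (auto simp: \<Gamma>_def homeomorphism_def intro!: exI[of _ "\<lambda>u. u"])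

lemma \<Gamma>_continuous: "\<gamma> \<in> \<Gamma> V R \<Longrightarrow> continuous_on A \<gamma>"
  unfolding \<Gamma>_def homeomorphism_def by (auto intro: continuous_on_subset)

lemma bdd_above_on_\<Gamma>:
  fixes J :: "'x::banach \<Rightarrow> real"
  assumes J: "continuous_on UNIV J" and V: "compact (V \<inter> cball 0 R)"
    and J_le: "\<And>u. u \<in> V \<Longrightarrow> norm u \<ge> R \<Longrightarrow> J u \<le> 0" and \<gamma>: "\<gamma> \<in> \<Gamma> V R"
  shows "bdd_above ((\<lambda>u. J (\<gamma> u)) ` V)"
proof -
  have "compact ((\<lambda>u. J (\<gamma> u)) ` (V \<inter> cball 0 R))"
    by (rule compact_continuous_image[OF _ V])
      (rule continuous_on_compose2[OF J \<Gamma>_continuous[OF \<gamma>]], simp)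
  then have "bdd_above ((\<lambda>u. J (\<gamma> u)) ` (V \<inter> cball 0 R))"
    by (simp add: compact_imp_bounded bounded_imp_bdd_above)
  then obtain c where c: "\<forall>u\<in>V \<inter> cball 0 R. J (\<gamma> u) \<le> c" unfolding bdd_above_def by blast
  have "J (\<gamma> u) \<le> max c 0" if "u \<in> V" for u
  proof (cases "norm u \<le> R")
    case True
    then have "J (\<gamma> u) \<le> c" using c that by simp
    then show ?thesis by simp
  next
    case False
    then have "\<gamma> u = u" using \<gamma> that by (auto simp: \<Gamma>_def)
    then show ?thesis using J_le[OF that] False by auto
  qed
  then show ?thesis by (rule bdd_aboveI2)
qed

text \<open>
  The displacements of the maps telescope against the decrease of \<open>\<Psi>\<close>, which makes the sequence uniformly
  Cauchy and bounds the distance of its limit from the first map.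
\<close>

lemma limit_on_compact:
  fixes g :: "nat \<Rightarrow> 'x::banach \<Rightarrow> 'y::banach" and \<Psi> :: "nat \<Rightarrow> real"
  assumes step: "\<And>m u. u \<in> Q \<Longrightarrow> c * norm (g m u - g (Suc m) u) \<le> \<Psi> m - \<Psi> (Suc m)"
    and c: "c > 0" and bound: "\<And>m. \<beta> \<le> \<Psi> m" and cont: "\<And>m. continuous_on Q (g m)" and "Q \<noteq> {}"
  obtains G s where "uniform_limit Q g G sequentially" "continuous_on Q G" "\<Psi> \<longlonglongrightarrow> s"
    "\<And>m. s \<le> \<Psi> m" "\<And>u. u \<in> Q \<Longrightarrow> c * norm (g 0 u - G u) \<le> \<Psi> 0 - s"
proof -
  have tele: "c * norm (g m u - g (m + k) u) \<le> \<Psi> m - \<Psi> (m + k)" if "u \<in> Q" for m k u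
  proof (induction k)
    case (Suc k)
    have "norm (g m u - g (m + Suc k) u) \<le> norm (g m u - g (m + k) u) + norm (g (m + k) u - g (Suc (m + k)) u)"
      using norm_triangle_ineq[of "g m u - g (m + k) u" "g (m + k) u - g (Suc (m + k)) u"] by simp
    then have "c * norm (g m u - g (m + Suc k) u) \<le> c * norm (g m u - g (m + k) u) + c * norm (g (m + k) u - g (Suc (m + k)) u)"
      using c by (simp add: mult_left_mono flip: distrib_left)
    then show ?case using Suc.IH step[OF that, of "m + k"] by simp
  qed simp
  have dec: "decseq \<Psi>"
  proof (rule decseq_SucI)
    fix m
    obtain u where "u \<in> Q" using \<open>Q \<noteq> {}\<close> by blast
    then have "0 \<le> \<Psi> m - \<Psi> (Suc m)" using step[of u m] c by (meson mult_nonneg_nonneg norm_ge_zero order_trans less_imp_le)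
    then show "\<Psi> (Suc m) \<le> \<Psi> m" by simp
  qed
  obtain s where s: "\<Psi> \<longlonglongrightarrow> s" "\<And>m. s \<le> \<Psi> m"
    using decseq_convergent[OF dec] bound by blast
  have close: "c * norm (g m u - g k u) \<le> \<Psi> m - s" if "u \<in> Q" "m \<le> k" for m k u
    using tele[OF that(1), of m "k - m"] that(2) s(2)[of k] by simp
  have "uniformly_Cauchy_on Q g"
  proof (rule uniformly_Cauchy_onI')
    fix e :: real assume "e > 0"
    then have "c * e > 0" using c by simp
    then obtain M where M: "\<And>m. m \<ge> M \<Longrightarrow> \<bar>\<Psi> m - s\<bar> < c * e"
      using LIMSEQ_D[OF s(1), of "c * e"] by auto
    show "\<exists>M. \<forall>u\<in>Q. \<forall>m\<ge>M. \<forall>k>m. dist (g m u) (g k u) < e"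
    proof (intro exI[of _ M] ballI allI impI)
      fix u m k assume "u \<in> Q" "M \<le> m" "m < k"
      then have "c * norm (g m u - g k u) < c * e" using close[of u m k] M[of m] by linarith
      then show "dist (g m u) (g k u) < e" using c by (simp add: dist_norm)
    qed
  qed
  then have "uniformly_convergent_on Q g" by (rule Cauchy_uniformly_convergent)
  then obtain G where G: "uniform_limit Q g G sequentially" by (auto simp: uniformly_convergent_on_def)
  moreover have "continuous_on Q G" by (rule uniform_limit_theorem[OF _ G]) (auto simp: cont)
  moreover have "c * norm (g 0 u - G u) \<le> \<Psi> 0 - s" if u: "u \<in> Q" for u
  proof (rule tendsto_upperbound)
    show "((\<lambda>k. c * norm (g 0 u - g k u)) \<longlongrightarrow> c * norm (g 0 u - G u)) sequentially"
      by (intro tendsto_intros tendsto_uniform_limitI[OF G u])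
  qed (use close[OF u, of 0] in auto)
  ultimately show thesis using that s by blast
qed

text \<open>
  Here the sequence \<open>g\<close> of \<open>ekeland_sequence\<close> in \<open>\<Gamma> V R\<close>, with the uniform distance on \<open>Q\<close>, meets the homeomorphism \<open>\<eta>\<close> of
  \<open>odd_descent_homeomorphism\<close>, applied to the image of the limit of \<open>g\<close>. If \<open>J\<close> had no almost critical points near the minimax level, then
  composing \<open>\<eta>\<close> with \<open>g m\<close> would lower the supremum by almost \<open>2 * c * t\<close> at the cost \<open>c * t\<close>, for all
  large \<open>m\<close> and with \<open>t\<close> not depending on \<open>m\<close>.
\<close>

lemma minimax_level_almost_critical:
  fixes J :: "'x::banach \<Rightarrow> real"
  assumes J: "\<And>u. (J has_derivative blinfun_apply (dJ u)) (at u)" and dJ: "continuous_on UNIV dJ"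
    and even: "\<And>u. J (- u) = J u" and V: "compact (V \<inter> cball 0 R)" "0 \<in> V" "0 < R"
    and J_le: "\<And>u. u \<in> V \<Longrightarrow> norm u \<ge> R \<Longrightarrow> J u \<le> 0"
    and linking: "\<And>\<gamma>. \<gamma> \<in> \<Gamma> V R \<Longrightarrow> \<exists>u\<in>V. \<rho> \<le> J (\<gamma> u)" and \<rho>: "0 < \<rho>"
    and "0 < \<epsilon>" "0 < \<alpha>"
  shows "\<exists>u. \<bar>J u - minimax_level J V R\<bar> \<le> \<epsilon> \<and> norm (dJ u) * (1 + norm u) < \<alpha>"
proof (rule ccontr)
  define \<beta> where "\<beta> = minimax_level J V R"
  assume "\<not> ?thesis"
  then have regular: "\<alpha> \<le> norm (dJ u) * (1 + norm u)" if "\<bar>J u - \<beta>\<bar> \<le> \<epsilon>" for u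
    using that unfolding \<beta>_def by (meson not_le)
  define Q where "Q = V \<inter> cball 0 R"
  have Q: "compact Q" "Q \<noteq> {}" "Q \<subseteq> V" using V by (auto simp: Q_def)
  have J_cont: "continuous_on A J" for A
    using J by (meson has_derivative_continuous_on has_derivative_at_withinI)
  define \<Psi> where "\<Psi> \<gamma> = (SUP u\<in>V. J (\<gamma> u))" for \<gamma>
  have bdd: "bdd_above ((\<lambda>u. J (\<gamma> u)) ` V)" if "\<gamma> \<in> \<Gamma> V R" for \<gamma>
    by (rule bdd_above_on_\<Gamma>[OF J_cont V(1) J_le that])
  have \<Psi>_upper: "J (\<gamma> u) \<le> \<Psi> \<gamma>" if "\<gamma> \<in> \<Gamma> V R" "u \<in> V" for \<gamma> u
    unfolding \<Psi>_def by (rule cSUP_upper[OF that(2) bdd[OF that(1)]])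
  have \<Psi>_\<rho>: "\<rho> \<le> \<Psi> \<gamma>" if "\<gamma> \<in> \<Gamma> V R" for \<gamma>
    using linking[OF that] \<Psi>_upper[OF that] by force
  have \<beta>_eq: "\<beta> = (INF \<gamma>\<in>\<Gamma> V R. \<Psi> \<gamma>)" by (simp add: \<beta>_def minimax_level_def \<Psi>_def)
  have \<beta>_le: "\<beta> \<le> \<Psi> \<gamma>" if "\<gamma> \<in> \<Gamma> V R" for \<gamma>
    unfolding \<beta>_eq using \<Psi>_\<rho> by (intro cINF_lower[OF _ that] bdd_belowI2[of _ \<rho>])
  have \<Gamma>_ne: "\<Gamma> V R \<noteq> {}" using id_in_\<Gamma> by blast
  have "\<rho> \<le> \<beta>" unfolding \<beta>_eq by (rule cINF_greatest[OF \<Gamma>_ne \<Psi>_\<rho>])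
  have \<Psi>_le: "\<Psi> \<gamma> \<le> c" if \<gamma>: "\<gamma> \<in> \<Gamma> V R" and c: "\<And>u. u \<in> Q \<Longrightarrow> J (\<gamma> u) \<le> c" for \<gamma> c
  proof -
    have "J (\<gamma> u) \<le> max c 0" if "u \<in> V" for u
    proof (cases "norm u \<le> R")
      case True
      then show ?thesis using c[of u] that by (auto simp: Q_def)
    next
      case False
      then have "\<gamma> u = u" using \<gamma> that by (auto simp: \<Gamma>_def)
      then show ?thesis using J_le[OF that] False by auto
    qed
    then have "\<Psi> \<gamma> \<le> max c 0" unfolding \<Psi>_def using V(2) by (intro cSUP_least) auto
    then show ?thesis using \<Psi>_\<rho>[OF \<gamma>] \<rho> by auto
  qed
  \<comment> \<open>With \<open>e \<le> \<alpha> / 8\<close> the total displacement, at most \<open>e / c\<close>, does not exceed \<open>A + 1\<close>.\<close>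
  define e where "e = min \<epsilon> (min (\<alpha> / 8) (\<beta> / 2))"
  have e: "0 < e" "e \<le> \<epsilon>" "e \<le> \<alpha> / 8" "e < \<beta>"
    using \<open>0 < \<epsilon>\<close> \<open>0 < \<alpha>\<close> \<open>\<rho> \<le> \<beta>\<close> \<rho> by (auto simp: e_def)
  obtain g0 where g0: "g0 \<in> \<Gamma> V R" "\<Psi> g0 < \<beta> + e"
  proof -
    have "Inf (\<Psi> ` \<Gamma> V R) < \<beta> + e" using e(1) \<beta>_eq by simp
    then show thesis using cInf_lessD[of "\<Psi> ` \<Gamma> V R"] \<Gamma>_ne that by blast
  qed
  obtain A where A: "\<And>u. u \<in> Q \<Longrightarrow> norm (g0 u) \<le> A" "0 \<le> A"
  proof -
    have "bounded (g0 ` Q)" by (intro compact_imp_bounded compact_continuous_image \<Gamma>_continuous[OF g0(1)] Q(1))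
    then obtain A where "\<forall>x\<in>g0 ` Q. norm x \<le> A" by (auto simp: bounded_iff)
    then show thesis using that[of A] Q(2) norm_ge_zero order_trans by (metis all_not_in_conv imageI)
  qed
  define c where "c = \<alpha> / 8 / (A + 1)"
  have \<alpha>_eq: "\<alpha> / 8 = c * (A + 1)"
    unfolding c_def by (rule nonzero_divide_eq_eq[THEN iffD1, OF _ refl]) (use A(2) in simp)
  have c: "c > 0" using \<open>0 < \<alpha>\<close> A(2) by (simp add: c_def)
  define d where "d g h = (SUP u\<in>Q. norm (g u - h u))" for g h :: "'x \<Rightarrow> 'x"
  have d_upper: "norm (g u - h u) \<le> d g h" if "g \<in> \<Gamma> V R" "h \<in> \<Gamma> V R" "u \<in> Q" for g h u
  proof -
    have "compact ((\<lambda>u. norm (g u - h u)) ` Q)"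
      by (intro compact_continuous_image Q(1) continuous_intros \<Gamma>_continuous[OF that(1)] \<Gamma>_continuous[OF that(2)])
    then have "bdd_above ((\<lambda>u. norm (g u - h u)) ` Q)" by (simp add: compact_imp_bounded bounded_imp_bdd_above)
    then show ?thesis unfolding d_def by (rule cSUP_upper[OF that(3)])
  qed
  have d_refl: "d g g = 0" for g using Q(2) by (simp add: d_def)
  have "\<exists>g. g 0 = g0 \<and> (\<forall>m. g m \<in> \<Gamma> V R) \<and>
      (\<forall>m. \<Psi> (g (Suc m)) + c * d (g m) (g (Suc m)) \<le> \<Psi> (g m)) \<and>
      (\<forall>m. \<forall>h\<in>\<Gamma> V R. \<Psi> h + c * d (g m) h \<le> \<Psi> (g m) \<longrightarrow> \<Psi> (g (Suc m)) - (1/2) ^ m \<le> \<Psi> h)"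
    by (rule ekeland_sequence[OF g0(1) \<beta>_le d_refl])
  then obtain g where g: "g 0 = g0" "\<And>m. g m \<in> \<Gamma> V R"
      "\<And>m. \<Psi> (g (Suc m)) + c * d (g m) (g (Suc m)) \<le> \<Psi> (g m)"
      "\<And>m h. h \<in> \<Gamma> V R \<Longrightarrow> \<Psi> h + c * d (g m) h \<le> \<Psi> (g m) \<Longrightarrow> \<Psi> (g (Suc m)) - (1/2) ^ m \<le> \<Psi> h"
    by blast
  obtain G s where G: "uniform_limit Q g G sequentially" "continuous_on Q G"
    and s: "(\<lambda>m. \<Psi> (g m)) \<longlonglongrightarrow> s" "\<And>m. s \<le> \<Psi> (g m)"
    and G_near: "\<And>u. u \<in> Q \<Longrightarrow> c * norm (g 0 u - G u) \<le> \<Psi> (g 0) - s"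
  proof (rule limit_on_compact[of Q c g "\<lambda>m. \<Psi> (g m)" \<beta>])
    fix m u assume "u \<in> Q"
    then have "c * norm (g m u - g (Suc m) u) \<le> c * d (g m) (g (Suc m))"
      using c d_upper g(2) by (intro mult_left_mono) auto
    then show "c * norm (g m u - g (Suc m) u) \<le> \<Psi> (g m) - \<Psi> (g (Suc m))" using g(3)[of m] by linarith
  qed (use c \<beta>_le g(2) \<Gamma>_continuous[OF g(2)] Q(2) in auto)
  have s_bounds: "\<beta> \<le> s" "s < \<beta> + e"
  proof -
    show "\<beta> \<le> s" by (rule LIMSEQ_le_const[OF s(1)]) (use \<beta>_le g(2) in blast)
    show "s < \<beta> + e" using s(2)[of 0] g0(2) g(1) by simp
  qed
  define K where "K = G ` Q"
  have "compact K" unfolding K_def by (rule compact_continuous_image[OF G(2) Q(1)])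
  have K_le: "J x \<le> s" if x: "x \<in> K" for x
  proof -
    obtain u where u: "u \<in> Q" "x = G u" using x by (auto simp: K_def)
    have "(\<lambda>m. J (g m u)) \<longlonglongrightarrow> J (G u)"
      by (rule continuous_on_tendsto_compose[OF J_cont[of UNIV] tendsto_uniform_limitI[OF G(1) u(1)]]) auto
    then have "J (G u) \<le> s"
      by (rule LIMSEQ_le[OF _ s(1)]) (use \<Psi>_upper g(2) u(1) Q(3) in blast)
    then show ?thesis using u by simp
  qed
  have K_norm: "norm x \<le> 2 * A + 1" if x: "x \<in> K" for x
  proof -
    obtain u where u: "u \<in> Q" "x = G u" using x by (auto simp: K_def)
    have "c * norm (g0 u - G u) \<le> e" using G_near[OF u(1)] s_bounds g0(2) g(1) by simp
    also have "e \<le> \<alpha> / 8" by (rule e(3))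
    also note \<alpha>_eq
    finally have "norm (g0 u - G u) \<le> A + 1" using c by simp
    moreover have "norm (G u) \<le> norm (g0 u) + norm (g0 u - G u)" by (metis norm_triangle_sub norm_minus_commute)
    ultimately show ?thesis using A(1)[OF u(1)] u(2) by simp
  qed
  \<comment> \<open>On \<open>K\<close> the weight \<open>1 + norm x\<close> is at most \<open>2 * (A + 1)\<close>, so the derivative has norm at least \<open>4 * c\<close>.\<close>
  have K_regular: "2 * c < norm (dJ x)" if x: "x \<in> K" "s - e \<le> J x" for x
  proof -
    have "\<bar>J x - \<beta>\<bar> \<le> \<epsilon>" using K_le[OF x(1)] x(2) s_bounds e(2) by linarith
    then have "\<alpha> \<le> norm (dJ x) * (1 + norm x)" by (rule regular)
    also have "\<dots> \<le> norm (dJ x) * (2 * (A + 1))" using K_norm[OF x(1)] by (intro mult_left_mono) auto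
    finally have "4 * c * (2 * (A + 1)) \<le> norm (dJ x) * (2 * (A + 1))"
      using \<alpha>_eq by (simp add: algebra_simps)
    then have "4 * c \<le> norm (dJ x)" by (rule mult_right_le_imp_le) (use A(2) in simp)
    then show ?thesis using c by linarith
  qed
  have "\<exists>\<eta> \<eta>' t. 0 < t \<and> homeomorphism UNIV UNIV \<eta> \<eta>' \<and> (\<forall>y. \<eta> (- y) = - \<eta> y) \<and>
     (\<forall>y. J y \<le> 0 \<longrightarrow> \<eta> y = y) \<and> (\<forall>y. norm (\<eta> y - y) \<le> t) \<and> (\<forall>y\<in>K. J (\<eta> y) \<le> s - 2 * c * t)"
    by (rule odd_descent_homeomorphism[OF J dJ even \<open>compact K\<close> K_le e(1) _ _ K_regular])
      (use c s_bounds e(4) in auto)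
  then obtain \<eta> \<eta>' t where t: "0 < t" and \<eta>: "homeomorphism UNIV UNIV \<eta> \<eta>'" "\<And>y. \<eta> (- y) = - \<eta> y"
      "\<And>y. J y \<le> 0 \<Longrightarrow> \<eta> y = y" "\<And>y. norm (\<eta> y - y) \<le> t" "\<And>y. y \<in> K \<Longrightarrow> J (\<eta> y) \<le> s - 2 * c * t"
    by blast
  have h: "\<eta> \<circ> g m \<in> \<Gamma> V R" for m
    by (rule homeomorphism_comp_in_\<Gamma>[OF g(2) \<eta>(1,2)]) (use \<eta>(3) J_le in auto)
  have "continuous_on UNIV (\<lambda>y. J (\<eta> y))"
    using \<eta>(1) by (intro continuous_on_compose2[OF J_cont[of UNIV]]) (auto simp: homeomorphism_def)
  then obtain r where r: "r > 0" "\<And>x y. x \<in> K \<Longrightarrow> dist x y < r \<Longrightarrow> \<bar>J (\<eta> x) - J (\<eta> y)\<bar> < c * t / 2"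
    using compact_image_uniformly_close[OF \<open>compact K\<close>, of "\<lambda>y. J (\<eta> y)" "c * t / 2"] c t by auto
  have "eventually (\<lambda>m. \<forall>u\<in>Q. dist (g m u) (G u) < r) sequentially"
    using uniform_limitD[OF G(1) r(1)] .
  moreover have "eventually (\<lambda>m. (1/2 :: real) ^ m < c * t) sequentially"
  proof (rule order_tendstoD(2))
    show "(\<lambda>m. (1/2 :: real) ^ m) \<longlonglongrightarrow> 0" by (rule LIMSEQ_power_zero) simp
  qed (use c t in simp)
  ultimately have "eventually (\<lambda>m. (\<forall>u\<in>Q. dist (g m u) (G u) < r) \<and> (1/2 :: real) ^ m < c * t) sequentially"
    by (rule eventually_conj)
  then obtain m where m: "\<And>u. u \<in> Q \<Longrightarrow> dist (g m u) (G u) < r" "(1/2 :: real) ^ m < c * t"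
    using eventually_happens'[OF sequentially_bot] by blast
  have drop: "\<Psi> (\<eta> \<circ> g m) \<le> s - 3 / 2 * (c * t)"
  proof (rule \<Psi>_le[OF h])
    fix u assume u: "u \<in> Q"
    then have "G u \<in> K" by (simp add: K_def)
    then have "\<bar>J (\<eta> (G u)) - J (\<eta> (g m u))\<bar> < c * t / 2"
      using r(2)[of "G u" "g m u"] m(1)[OF u] by (simp add: dist_commute)
    moreover have "J (\<eta> (G u)) \<le> s - 2 * (c * t)" using \<eta>(5)[OF \<open>G u \<in> K\<close>] by (simp add: mult.assoc)
    ultimately show "J ((\<eta> \<circ> g m) u) \<le> s - 3 / 2 * (c * t)" unfolding comp_def by linarith
  qed
  have cost: "c * d (g m) (\<eta> \<circ> g m) \<le> c * t"
    unfolding d_def using c Q(2) \<eta>(4) by (intro mult_left_mono cSUP_least) (auto simp: norm_minus_commute)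
  have pos: "0 < c * t" using c t by simp
  have "\<Psi> (g (Suc m)) - (1/2) ^ m \<le> \<Psi> (\<eta> \<circ> g m)"
    by (rule g(4)[OF h]) (use drop cost pos s(2)[of m] in linarith)
  then have "3 / 2 * (c * t) \<le> (1/2) ^ m" using s(2)[of "Suc m"] drop by linarith
  then show False using m(2) pos by linarith
qed

theorem theorem2p4:
  fixes \<iota> :: "'x::banach \<Rightarrow> 'w::banach"
    and J :: "'x \<Rightarrow> real"
    and dJ :: "'x \<Rightarrow> 'x \<Rightarrow>\<^sub>L real"
    and \<rho> R :: real
    and V Z M N :: "'x set"
  assumes embedding: "bounded_linear \<iota>" "inj \<iota>"
    and J_C1: "\<And>u. (J has_derivative blinfun_apply (dJ u)) (at u)" "continuous_on UNIV dJ"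
    and J_even: "\<And>u. J (- u) = J u"
    and J_0: "J 0 = 0"
    and J_wCPS: "\<And>\<beta>. \<beta> > 0 \<Longrightarrow> wCPS \<iota> J dJ \<beta>"
    and pos: "\<rho> > 0" "R > 0"
    and closed: "closed V" "closed Z" "closed M"
    and subspaces: "subspace V" "subspace Z"
    and sum_V_Z: "{v + z | v z. v \<in> V \<and> z \<in> Z} = UNIV"
    and V_findim: "\<exists>B. finite B \<and> V = span B"
    and codim_less: "codim Z < enat (dim V)"
    and M_frontier: "M = frontier N"
    and N_nhd: "0 \<in> interior N"
    and N_symmetric: "\<And>u. u \<in> N \<Longrightarrow> - u \<in> N"
    and N_bounded: "bounded (\<iota> ` N)"
    and J_ge: "\<And>u. u \<in> M \<inter> Z \<Longrightarrow> J u \<ge> \<rho>"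
    and J_le: "\<And>u. u \<in> V \<Longrightarrow> norm u \<ge> R \<Longrightarrow> J u \<le> 0"
  shows "(\<exists>u. u \<noteq> - u \<and> dJ u = 0 \<and> dJ (- u) = 0 \<and>
              J u = minimax_level J V R \<and> J (- u) = minimax_level J V R) \<and>
         (\<forall>\<rho>\<^sub>1. \<rho>\<^sub>1 \<ge> (SUP u\<in>V. J u) \<longrightarrow> minimax_level J V R \<in> {\<rho>..\<rho>\<^sub>1})"
proof -
  define \<beta> where "\<beta> = minimax_level J V R"
  have linking: "\<exists>u\<in>V. \<rho> \<le> J (\<gamma> u)" if "\<gamma> \<in> \<Gamma> V R" for \<gamma>
    using image_meets_frontier_of_neighborhood[OF embedding closed(2) subspaces(2) V_findim codim_less
        N_nhd N_symmetric N_bounded that] J_ge M_frontier by (metis IntI)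
  have V_compact: "compact (V \<inter> cball 0 R)"
  proof -
    have "\<exists>e. V = span (e ` {..<dim V}) \<and>
        (\<forall>c. (\<Sum>i<dim V. c i *\<^sub>R e i) = 0 \<longrightarrow> (\<forall>i<dim V. c i = 0))"
      by (rule finite_dim_indexed_basis[OF V_findim])
    then obtain e where e: "V = span (e ` {..<dim V})"
        "\<forall>c. (\<Sum>i<dim V. c i *\<^sub>R e i) = 0 \<longrightarrow> (\<forall>i<dim V. c i = 0)"
      by (elim exE conjE)
    have "compact (span (e ` {..<dim V}) \<inter> cball 0 R)" by (rule compact_span_Int_cball) (use e(2) in blast)
    then show ?thesis using e(1) by simp
  qed
  have "0 \<in> V" by (rule subspace_0[OF subspaces(1)])
  have J_cont: "continuous_on UNIV J"
    using J_C1(1) by (meson has_derivative_continuous_on has_derivative_at_withinI)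
  define \<Psi> where "\<Psi> \<gamma> = (SUP u\<in>V. J (\<gamma> u))" for \<gamma>
  have \<Psi>_\<rho>: "\<rho> \<le> \<Psi> \<gamma>" if \<gamma>: "\<gamma> \<in> \<Gamma> V R" for \<gamma>
    using linking[OF \<gamma>] cSUP_upper[OF _ bdd_above_on_\<Gamma>[OF J_cont V_compact J_le \<gamma>]] by (force simp: \<Psi>_def)
  have \<beta>_eq: "\<beta> = (INF \<gamma>\<in>\<Gamma> V R. \<Psi> \<gamma>)" by (simp add: \<beta>_def minimax_level_def \<Psi>_def)
  have "\<rho> \<le> \<beta>" unfolding \<beta>_eq using id_in_\<Gamma> \<Psi>_\<rho> by (intro cINF_greatest) auto
  have "\<beta> \<le> \<Psi> (\<lambda>u. u)"
    unfolding \<beta>_eq using \<Psi>_\<rho> by (intro cINF_lower[OF _ id_in_\<Gamma>] bdd_belowI2[of _ \<rho>])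
  have "\<exists>u. J u = \<beta> \<and> dJ u = 0"
  proof -
    have "\<exists>u. \<bar>J u - \<beta>\<bar> \<le> 1 / real (Suc n) \<and> norm (dJ u) * (1 + norm u) < 1 / real (Suc n)" for n
      unfolding \<beta>_def
      by (rule minimax_level_almost_critical[OF J_C1 J_even V_compact \<open>0 \<in> V\<close> pos(2) J_le linking pos(1)]) auto
    then obtain u where u: "\<And>n. \<bar>J (u n) - \<beta>\<bar> \<le> 1 / real (Suc n)"
        "\<And>n. norm (dJ (u n)) * (1 + norm (u n)) < 1 / real (Suc n)" by metis
    have lim: "(\<lambda>n. 1 / real (Suc n)) \<longlonglongrightarrow> 0" using LIMSEQ_Suc[OF lim_1_over_n] by simp
    have "(\<lambda>n. J (u n) - \<beta>) \<longlonglongrightarrow> 0" using u(1) by (intro Lim_null_comparison[OF _ lim]) auto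
    then have "(\<lambda>n. J (u n)) \<longlonglongrightarrow> \<beta>" by (rule LIM_zero_cancel)
    moreover have "(\<lambda>n. norm (dJ (u n)) * (1 + norm (u n))) \<longlonglongrightarrow> 0"
      using u(2) by (intro Lim_null_comparison[OF _ lim]) (auto simp: less_imp_le)
    ultimately have "CPS_seq J dJ \<beta> u" by (simp add: CPS_seq_def)
    moreover have "wCPS \<iota> J dJ \<beta>" using J_wCPS \<open>\<rho> \<le> \<beta>\<close> pos(1) by simp
    ultimately show ?thesis unfolding wCPS_def by blast
  qed
  then obtain u where u: "J u = \<beta>" "dJ u = 0" by blast
  have "u \<noteq> - u"
  proof
    assume "u = - u"
    then have "2 *\<^sub>R u = 0" by (metis add.right_inverse scaleR_2)
    then show False using u(1) J_0 \<open>\<rho> \<le> \<beta>\<close> pos(1) by simp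
  qed
  moreover have "dJ (- u) = 0" using derivative_even[OF J_C1(1) J_even, of u] u(2) by simp
  ultimately have "\<exists>u. u \<noteq> - u \<and> dJ u = 0 \<and> dJ (- u) = 0 \<and> J u = \<beta> \<and> J (- u) = \<beta>"
    using u J_even by blast
  then show ?thesis using \<open>\<rho> \<le> \<beta>\<close> \<open>\<beta> \<le> \<Psi> (\<lambda>u. u)\<close> unfolding \<beta>_def \<Psi>_def by auto
qed

end
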